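(* Let $0<p<\infty$, $0<r<1$ and $\omega\in\widehat{\mathcal{D}}$. Let $\nu$ be a positive Borel measure on $\mathbb{D}$, and for each $z\in\mathbb{D}$ let $E(z)\subset\Delta(z,r)$ be such that $\nu(E(z))>0$. For $f\in A^p_\omega$ and $\varepsilon>0$ let $$Q(f)(z)=\frac1{\nu(E(z))}\int_{E(z)}|f(\zeta)|^p\,d\nu(\zeta),\quad z\in\mathbb{D},\qquad E=E(f,\nu)=\{z\in\mathbb{D}:|f(z)|^p\le\varepsilon\,Q(f)(z)\}.$$ Then there exists a constant $C=C(r,\omega)>0$ such that $$\int_E|f(z)|^p\omega(z)\,dA(z)\le C\varepsilon\|f\|_{A^p_\omega}^p,$$ and thus $\mathbb{D}\setminus E$ is a dominating set for $f\in A^p_\omega$ if $\varepsilon=\varepsilon(r,\omega)>0$ is sufficiently small.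
   Context: $\mathbb{D}=\{z\in\mathbb{C}:|z|<1\}$, $\mathcal{H}(\mathbb{D})$ is the space of analytic functions in $\mathbb{D}$, and $dA(z)=\frac{dx\,dy}{\pi}$. A weight is a function $\omega:\mathbb{D}\to[0,\infty)$ integrable over $\mathbb{D}$ (with respect to $dA$); it is radial if $\omega(z)=\omega(|z|)$. $A^p_\omega$ consists of $f\in\mathcal{H}(\mathbb{D})$ with $\|f\|_{A^p_\omega}^p=\int_{\mathbb{D}}|f|^p\omega\,dA<\infty$. For a radial weight $\omega$ put $\widehat\omega(z)=\int_{|z|}^1\omega(s)\,ds$; it is assumed that $\widehat\omega(z)>0$ for all $z\in\mathbb{D}$. A radial weight $\omega$ belongs to $\widehat{\mathcal{D}}$ if there exists $C\ge1$ such that $\widehat\omega(r)\le C\widehat\omega(\frac{1+r}{2})$ for all $0\le r<1$. $\Delta(z,r)=\{\zeta\in\mathbb{D}:|\varphi_z(\zeta)|<r\}$ is the pseudohyperbolic disc, where $\varphi_a(z)=\frac{a-z}{1-\overline az}$. The sets $E(z)$ are measurable and $\nu$ is finite on compact subsets of $\mathbb{D}$, with measurability such that the integrals and the set $E$ make sense. A measurable set $G=G(f)\subset\mathbb{D}$ is a dominating set for $f\in A^p_\omega$ if there exists $\delta=\delta(G)>0$ such that $\int_G|f|^p\omega\,dA\ge\delta\|f\|_{A^p_\omega}^p$. Notation such as $C=C(r,\omega)$ means that the constant depends only on the listed parameters. *)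

theory Defs
  imports "HOL-Complex_Analysis.Complex_Analysis"
begin

abbreviation unit_disc :: "complex set" ("\<bbbD>") where
  "\<bbbD> \<equiv> ball 0 1"

text \<open>The measure \<open>dA = dx dy / \<pi>\<close>, living on the unit disc.\<close>

definition disc_area :: "complex measure" where
  "disc_area = scale_measure (ennreal (1 / pi)) (lebesgue_on \<bbbD>)"

text \<open>Weights, and functions on the disc in general, are total functions on the complex plane;
  only their values in the disc are ever used.\<close>

definition weight :: "(complex \<Rightarrow> real) \<Rightarrow> bool" where
  "weight \<omega> \<longleftrightarrow> (\<forall>z\<in>\<bbbD>. 0 \<le> \<omega> z) \<and> integrable disc_area \<omega>"

definition radial_weight :: "(complex \<Rightarrow> real) \<Rightarrow> bool" where
  "radial_weight \<omega> \<longleftrightarrow> weight \<omega> \<and> (\<forall>z\<in>\<bbbD>. \<omega> z = \<omega> (of_real (cmod z)))"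

text \<open>Integrability over the disc controls \<open>\<integral> \<omega>(s) s ds\<close> only, so the value at \<open>0\<close> may be infinite for
  a radial weight; hence the type \<^typ>\<open>ennreal\<close>.  The doubling condition below, at \<open>r = 0\<close>,
  excludes the infinite value.\<close>

definition weight_hat :: "(complex \<Rightarrow> real) \<Rightarrow> complex \<Rightarrow> ennreal" where
  "weight_hat \<omega> z = (\<integral>\<^sup>+ s \<in> {cmod z..<1}. ennreal (\<omega> (of_real s)) \<partial>lebesgue)"

definition D_hat :: "(complex \<Rightarrow> real) set" where
  "D_hat = {\<omega>. radial_weight \<omega> \<and>
     (\<exists>C::real. C \<ge> 1 \<and> (\<forall>r::real. 0 \<le> r \<and> r < 1 \<longrightarrow>
        weight_hat \<omega> (of_real r) \<le> ennreal C * weight_hat \<omega> (of_real ((1 + r) / 2))))}"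

definition bergman_space :: "real \<Rightarrow> (complex \<Rightarrow> real) \<Rightarrow> (complex \<Rightarrow> complex) set" where
  "bergman_space p \<omega> =
     {f. f holomorphic_on \<bbbD> \<and> integrable disc_area (\<lambda>z. cmod (f z) powr p * \<omega> z)}"

definition bergman_norm :: "real \<Rightarrow> (complex \<Rightarrow> real) \<Rightarrow> (complex \<Rightarrow> complex) \<Rightarrow> real" where
  "bergman_norm p \<omega> f = (LINT z|disc_area. cmod (f z) powr p * \<omega> z) powr (1 / p)"

definition disc_automorphism :: "complex \<Rightarrow> complex \<Rightarrow> complex" where
  "disc_automorphism a z = (a - z) / (1 - cnj a * z)"

definition pseudohyperbolic_disc :: "complex \<Rightarrow> real \<Rightarrow> complex set" where
  "pseudohyperbolic_disc z r = {\<zeta>\<in>\<bbbD>. cmod (disc_automorphism z \<zeta>) < r}"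

definition locally_finite_disc_measure :: "complex measure \<Rightarrow> bool" where
  "locally_finite_disc_measure \<nu> \<longleftrightarrow>
     sets \<nu> = sets (restrict_space borel \<bbbD>) \<and>
     (\<forall>K. compact K \<and> K \<subseteq> \<bbbD> \<longrightarrow> emeasure \<nu> K < \<infinity>)"

definition local_average ::
    "real \<Rightarrow> complex measure \<Rightarrow> (complex \<Rightarrow> complex set) \<Rightarrow> (complex \<Rightarrow> complex) \<Rightarrow> complex \<Rightarrow> real" where
  "local_average p \<nu> E f z =
     1 / measure \<nu> (E z) * (LINT \<zeta>:E z|\<nu>. cmod (f \<zeta>) powr p)"

definition small_value_set ::
    "real \<Rightarrow> complex measure \<Rightarrow> (complex \<Rightarrow> complex set) \<Rightarrow> (complex \<Rightarrow> complex) \<Rightarrow> real \<Rightarrow> complex set" where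
  "small_value_set p \<nu> E f \<epsilon> = {z\<in>\<bbbD>. cmod (f z) powr p \<le> \<epsilon> * local_average p \<nu> E f z}"

definition dominating_set ::
    "real \<Rightarrow> (complex \<Rightarrow> real) \<Rightarrow> (complex \<Rightarrow> complex) \<Rightarrow> complex set \<Rightarrow> bool" where
  "dominating_set p \<omega> f G \<longleftrightarrow> G \<in> sets disc_area \<and>
     (\<exists>\<delta>>0. (LINT z:G|disc_area. cmod (f z) powr p * \<omega> z) \<ge> \<delta> * bergman_norm p \<omega> f powr p)"

end

theory Submission
  imports Defs
begin

text \<open>On \<open>E\<close> we have \<open>|f(z)|^p \<le> \<epsilon> sup |f|^p\<close> over \<open>\<Delta>(z,r)\<close>, and since \<open>|f|^p\<close> is
  subharmonic this supremum is at most a constant times the area average of \<open>|f|^p\<close> over a slightly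
  larger neighbourhood of \<open>z\<close>. Integrating against \<open>\<omega>\<close> and exchanging the integrals leaves
  \<open>\<integral> |f|^p V dA\<close>, where \<open>V(\<eta>)\<close> is an average of \<open>\<omega>\<close> near \<open>\<eta>\<close>. As \<open>V\<close> and \<open>\<omega>\<close> are radial, \<open>|f|^p\<close> may be
  replaced by its circular means, which increase with the radius; hence it suffices to compare the
  integrals of \<open>V\<close> and \<open>\<omega>\<close> over annuli \<open>t < |z| < 1\<close>, and this is the doubling condition defining the
  class. All constants coming from subharmonicity are independent of \<open>p\<close>.\<close>

subsection \<open>Circular means of powers of holomorphic functions\<close>

text \<open>A member of \<open>D_hat\<close> may vanish on large sets and oscillate freely, so V
  cannot be compared with \<omega> pointwise: doubling controls only the mass near the boundary.
  Tails suffice exactly for radially increasing factors, because the superlevel sets of such a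
  factor in the disc are annuli. This is why |f|^p itself, which has no such monotonicity, must
  first give way to its means.

  A second obstacle is measurability. The weight is only Lebesgue measurable on the disc, while the
  doubling condition integrates it along one radius, a null set of the plane. Before polar
  coordinates and the exchange of integrals apply, a Borel function w is needed with \<omega>(z) =
  w(|z|) almost everywhere, both in the disc and along the radius.

  The comparison is carried out with \<open>ennreal\<close> integrals, so that no finiteness of V or
  of the intermediate integrals has to be known beforehand.\<close>

lemma locally_holomorphic_powr:
  fixes f :: "complex \<Rightarrow> complex" and p :: real
  assumes "f holomorphic_on ball z e" and "\<And>w. w \<in> ball z e \<Longrightarrow> f w \<noteq> 0"
  obtains g where "g holomorphic_on ball z e" "\<And>w. w \<in> ball z e \<Longrightarrow> cmod (g w) = cmod (f w) powr p"
proof -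
  obtain h where h: "h holomorphic_on ball z e" "\<And>w. w \<in> ball z e \<Longrightarrow> f w = exp (h w)"
    using contractible_imp_holomorphic_log[OF assms(1) _ assms(2)]
    by (metis convex_ball convex_imp_contractible)
  show ?thesis
  proof
    show "(\<lambda>w. exp (of_real p * h w)) holomorphic_on ball z e"
      by (intro holomorphic_intros h)
    show "cmod (exp (of_real p * h w)) = cmod (f w) powr p" if "w \<in> ball z e" for w
      using h(2)[OF that] by (simp add: powr_def)
  qed
qed

text \<open>Near a maximum the summands that do not vanish there are moduli of holomorphic functions
  \<open>g\<^sub>i\<close>; multiplying these by constant phases that align their values at the maximum gives a sum to
  which the maximum modulus principle applies.\<close>

lemma sum_powr_locally_constant_at_maximum:
  fixes F :: "'i \<Rightarrow> complex \<Rightarrow> complex" and p :: real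
  assumes "finite I" and "open S" and hol: "\<And>i. i \<in> I \<Longrightarrow> F i holomorphic_on S"
    and z: "z \<in> S" and max: "\<And>w. w \<in> S \<Longrightarrow> (\<Sum>i\<in>I. cmod (F i w) powr p) \<le> (\<Sum>i\<in>I. cmod (F i z) powr p)"
  obtains e where "e > 0" "ball z e \<subseteq> S"
    "\<And>w. w \<in> ball z e \<Longrightarrow> (\<Sum>i\<in>I. cmod (F i w) powr p) = (\<Sum>i\<in>I. cmod (F i z) powr p)"
proof -
  define v where "v w = (\<Sum>i\<in>I. cmod (F i w) powr p)" for w
  \<comment> \<open>For these i a holomorphic function with modulus |F i|^p is available near z. The
    discarded summands vanish at z and are nonnegative elsewhere, so the sum over J equals v at z
    and stays below v around it.\<close>
  define J where "J = {i\<in>I. F i z \<noteq> 0}"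
  have J: "finite J" "J \<subseteq> I" using \<open>finite I\<close> by (auto simp: J_def)
  have cont: "isCont (F i) z" if "i \<in> I" for i
    using hol[OF that] z \<open>open S\<close> using continuous_on_eq_continuous_at holomorphic_on_imp_continuous_on by blast
  have "\<forall>i\<in>J. eventually (\<lambda>w. F i w \<noteq> 0) (nhds z)"
  proof
    fix i assume "i \<in> J"
    hence "i \<in> I" "F i z \<noteq> 0" by (auto simp: J_def)
    have "(F i \<longlongrightarrow> F i z) (nhds z)" using cont[OF \<open>i \<in> I\<close>] by (simp add: continuous_at_imp_continuous_at_within isCont_def tendsto_at_iff_tendsto_nhds)
    thus "eventually (\<lambda>w. F i w \<noteq> 0) (nhds z)" using \<open>F i z \<noteq> 0\<close> by (rule tendsto_imp_eventually_ne)
  qed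
  hence "eventually (\<lambda>w. \<forall>i\<in>J. F i w \<noteq> 0) (nhds z)" by (simp add: eventually_ball_finite J)
  hence "eventually (\<lambda>w. (\<forall>i\<in>J. F i w \<noteq> 0) \<and> w \<in> S) (nhds z)"
    using eventually_nhds_in_open[OF \<open>open S\<close> z] by eventually_elim auto
  then obtain e where e: "e > 0" "\<And>w. dist w z < e \<Longrightarrow> (\<forall>i\<in>J. F i w \<noteq> 0) \<and> w \<in> S"
    unfolding eventually_nhds_metric by auto
  have sub: "ball z e \<subseteq> S" using e(2) by (auto simp: dist_commute)
  have "\<exists>g. g holomorphic_on ball z e \<and> (\<forall>w\<in>ball z e. cmod (g w) = cmod (F i w) powr p)" if "i \<in> J" for i
  proof -
    have "F i holomorphic_on ball z e" using hol sub J that holomorphic_on_subset by blast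
    moreover have "F i w \<noteq> 0" if "w \<in> ball z e" for w using e(2)[of w] that \<open>i \<in> J\<close> by (auto simp: dist_commute)
    ultimately show ?thesis by (metis locally_holomorphic_powr)
  qed
  then obtain g where g: "\<And>i. i \<in> J \<Longrightarrow> g i holomorphic_on ball z e"
    "\<And>i w. i \<in> J \<Longrightarrow> w \<in> ball z e \<Longrightarrow> cmod (g i w) = cmod (F i w) powr p" by metis
  define G where "G w = (\<Sum>i\<in>J. cnj (sgn (g i z)) * g i w)" for w
  have "z \<in> ball z e" using e by simp
  have Gz: "cmod (G z) = v z"
  proof -
    have "cnj (sgn (g i z)) * g i z = of_real (cmod (g i z))" for i
    proof (cases "g i z = 0")
      case False
      have "cnj (sgn (g i z)) * g i z = (cnj (g i z) * g i z) / of_real (cmod (g i z))"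
        by (simp add: sgn_eq)
      also have "\<dots> = of_real (cmod (g i z))"
        using False by (simp add: mult.commute[of "cnj _"] complex_norm_square[symmetric] power2_eq_square)
      finally show ?thesis .
    qed simp
    hence "G z = of_real (\<Sum>i\<in>J. cmod (g i z))" by (simp add: G_def)
    hence "cmod (G z) = (\<Sum>i\<in>J. cmod (g i z))" by (simp only: norm_of_real abs_of_nonneg[OF sum_nonneg] norm_ge_zero)
    also have "\<dots> = (\<Sum>i\<in>J. cmod (F i z) powr p)" using g(2) \<open>z \<in> ball z e\<close> by simp
    also have "\<dots> = v z" unfolding v_def J_def by (rule sum.mono_neutral_left) (use \<open>finite I\<close> in auto)
    finally show ?thesis .
  qed
  have Gle: "cmod (G w) \<le> v w" if "w \<in> ball z e" for w
  proof -
    have "cmod (G w) \<le> (\<Sum>i\<in>J. cmod (g i w))"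
      unfolding G_def
      by (rule sum_norm_le) (auto simp: norm_mult norm_sgn)
    also have "\<dots> = (\<Sum>i\<in>J. cmod (F i w) powr p)" using g(2) that by simp
    also have "\<dots> \<le> v w" unfolding v_def by (rule sum_mono2) (use J \<open>finite I\<close> in auto)
    finally show ?thesis .
  qed
  have le: "v w \<le> v z" if "w \<in> ball z e" for w using max sub that by (auto simp: v_def)
  have "G constant_on ball z e"
  proof (rule maximum_modulus_principle)
    show "G holomorphic_on ball z e" unfolding G_def by (intro holomorphic_intros g)
    show "cmod (G w) \<le> cmod (G z)" if "w \<in> ball z e" for w
      using Gle[OF that] le[OF that] Gz by simp
    show "z \<in> ball z e" using e by simp
  qed auto
  hence "G w = G z" if "w \<in> ball z e" for w using that \<open>z \<in> ball z e\<close> unfolding constant_on_def by metis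
  \<comment> \<open>Squeeze: v z = |G z| = |G w| \<le> v w \<le> v z.\<close>
  hence "v w = v z" if "w \<in> ball z e" for w using Gle[OF that] le[OF that] Gz that by force
  thus ?thesis using that[OF e(1) sub] unfolding v_def by blast
qed

text \<open>The sum attains its maximum over the closed disc at some x. If x is interior, the set
  where the maximum is attained is open in the open disc by local constancy and closed by
  continuity, hence everything; continuity then carries the constant value to the boundary.\<close>

lemma sum_powr_maximum_principle:
  fixes F :: "'i \<Rightarrow> complex \<Rightarrow> complex" and p :: real
  assumes "finite I" and "p > 0" and hol: "\<And>i. i \<in> I \<Longrightarrow> F i holomorphic_on ball 0 R"
    and cont: "\<And>i. i \<in> I \<Longrightarrow> continuous_on (cball 0 R) (F i)"
    and "R > 0" and z: "z \<in> cball 0 R"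
  obtains w where "cmod w = R" "(\<Sum>i\<in>I. cmod (F i z) powr p) \<le> (\<Sum>i\<in>I. cmod (F i w) powr p)"
proof -
  define v where "v w = (\<Sum>i\<in>I. cmod (F i w) powr p)" for w
  have v: "continuous_on (cball 0 R) v" unfolding v_def
    using \<open>p > 0\<close> cont by (intro continuous_intros continuous_on_powr') auto
  obtain x where x: "x \<in> cball 0 R" "\<And>w. w \<in> cball 0 R \<Longrightarrow> v w \<le> v x"
    using continuous_attains_sup[OF _ _ v] \<open>R > 0\<close> by (auto simp: cball_eq_empty)
  show ?thesis
  proof (cases "cmod x = R")
    case True
    thus ?thesis using that[of x] x(2)[OF z] by (simp add: v_def)
  next
    case False
    hence xb: "x \<in> ball 0 R" using x by auto
    have "openin (top_of_set (ball 0 R)) {w\<in>ball 0 R. v w = v x}"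
    proof -
      have "open {w\<in>ball 0 R. v w = v x}"
      proof (rule openI)
        fix w assume w: "w \<in> {w\<in>ball 0 R. v w = v x}"
        obtain e where e: "e > 0" "ball w e \<subseteq> ball 0 R" "\<And>u. u \<in> ball w e \<Longrightarrow> v u = v w"
        proof (rule sum_powr_locally_constant_at_maximum[of I "ball 0 R" F w p])
          show "(\<Sum>i\<in>I. cmod (F i u) powr p) \<le> (\<Sum>i\<in>I. cmod (F i w) powr p)" if "u \<in> ball 0 R" for u
            using x(2)[of u] that w by (simp add: v_def)
          show "F i holomorphic_on ball 0 R" if "i \<in> I" for i by (rule hol[OF that])
          show "w \<in> ball 0 R" using w by simp
        qed (use \<open>finite I\<close> in \<open>unfold v_def, blast+\<close>)
        have "u \<in> {w\<in>ball 0 R. v w = v x}" if "u \<in> ball w e" for u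
          using e(2) e(3)[OF that] w that by (simp add: subset_iff del: mem_ball)
        thus "\<exists>e>0. ball w e \<subseteq> {w\<in>ball 0 R. v w = v x}" using e(1) by blast
      qed
      thus ?thesis by (metis (no_types, lifting) mem_Collect_eq openin_open_eq open_ball subsetI)
    qed
    moreover have "closedin (top_of_set (ball 0 R)) {w\<in>ball 0 R. v w = v x}"
      using continuous_closedin_preimage_constant[of "ball 0 R" v "v x"] v continuous_on_subset ball_subset_cball by blast
    moreover have "connected (ball (0::complex) R)" by simp
    ultimately have "{w\<in>ball 0 R. v w = v x} = ball 0 R" using xb unfolding connected_clopen by blast
    hence const: "v w = v x" if "w \<in> ball 0 R" for w using that by blast
    have "v w = v x" if "w \<in> cball 0 R" for w
      by (rule continuous_constant_on_closure[of "ball 0 R" v]) (use v const that \<open>R > 0\<close> in auto)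
    hence "v z = v (of_real R)" using z \<open>R > 0\<close> by (metis abs_of_pos mem_cball_0 norm_of_real order_refl)
    thus ?thesis using that[of "of_real R"] \<open>R > 0\<close> by (simp add: v_def)
  qed
qed

definition circle_mean :: "(complex \<Rightarrow> real) \<Rightarrow> complex \<Rightarrow> real" where
  "circle_mean u z = integral {0..1} (\<lambda>t. u (cis (2 * pi * t) * z))"

lemma integral_periodic_shift:
  fixes g :: "real \<Rightarrow> real"
  assumes cont: "continuous_on UNIV g" and per: "\<And>t. g (t + 1) = g t" and s: "0 \<le> s" "s \<le> 1"
  shows "integral {0..1} (\<lambda>t. g (t + s)) = integral {0..1} g"
proof -
  have int: "g integrable_on {a..b}" for a b
    by (rule integrable_continuous_real, rule continuous_on_subset[OF cont]) auto
  have shift: "integral {a..b} (\<lambda>t. g (t + c)) = integral {a + c..b + c} g" for a b c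
    using has_integral_affinity'[OF integrable_integral[OF int[of "a + c" "b + c", folded cbox_interval]], of 1 c]
    by (intro integral_unique) (simp add: cbox_interval)
  have "integral {0..1} (\<lambda>t. g (t + s)) = integral {s..1} g + integral {1..1 + s} g"
    using shift[of 0 1 s] Henstock_Kurzweil_Integration.integral_combine[of s 1 "1 + s" g] int s by simp
  also have "integral {1..1 + s} g = integral {0..s} g"
    using shift[of 0 s 1] per by (simp add: add.commute)
  also have "integral {s..1} g + integral {0..s} g = integral {0..1} g"
    using Henstock_Kurzweil_Integration.integral_combine[of 0 s 1 g] int s by simp
  finally show ?thesis .
qed

lemma norm_cis_diff_le: "cmod (cis s - cis t) \<le> \<bar>s - t\<bar>"
proof -
  have "cis s - cis t = cis t * (exp (\<i> * of_real (s - t)) - 1)"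
    by (simp add: cis_conv_exp algebra_simps flip: exp_add)
  hence "cmod (cis s - cis t) = 2 * \<bar>sin ((s - t) / 2)\<bar>"
    using dist_exp_i_1[of "s - t"] by (simp add: norm_mult)
  thus ?thesis using abs_sin_x_le_abs_x[of "(s - t) / 2"] by simp
qed

lemma circle_mean_rotate:
  assumes u: "continuous_on (cball 0 R) u" and "cmod z \<le> R" and "cmod c = 1"
  shows "circle_mean u (c * z) = circle_mean u z"
proof -
  define s where "s = Arg2pi c / (2 * pi)"
  have s: "0 \<le> s" "s \<le> 1" using Arg2pi[of c] by (auto simp: s_def)
  have c: "c = cis (2 * pi * s)" using Arg2pi_eq[of c] \<open>cmod c = 1\<close> by (simp add: s_def cis_conv_exp)
  have "integral {0..1} (\<lambda>t. (\<lambda>t. u (cis (2 * pi * t) * z)) (t + s)) = integral {0..1} (\<lambda>t. u (cis (2 * pi * t) * z))"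
  proof (rule integral_periodic_shift)
    show "continuous_on UNIV (\<lambda>t. u (cis (2 * pi * t) * z))"
      by (rule continuous_on_compose2[OF u]) (use \<open>cmod z \<le> R\<close> in \<open>auto intro!: continuous_intros simp: norm_mult\<close>)
    show "u (cis (2 * pi * (t + 1)) * z) = u (cis (2 * pi * t) * z)" for t
      by (simp add: distrib_left flip: cis_mult)
  qed (use s in auto)
  thus ?thesis by (simp add: circle_mean_def c distrib_left mult.assoc flip: cis_mult)
qed

lemma riemann_sum_bound:
  fixes g :: "real \<Rightarrow> real"
  assumes "N > 0" and cont: "continuous_on {0..1} g"
    and osc: "\<And>s t. s \<in> {0..1} \<Longrightarrow> t \<in> {0..1} \<Longrightarrow> \<bar>s - t\<bar> \<le> 1 / real N \<Longrightarrow> \<bar>g s - g t\<bar> \<le> e"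
  shows "\<bar>integral {0..1} g - (\<Sum>k<N. g (real k / real N)) / N\<bar> \<le> e"
proof -
  \<comment> \<open>Induction over the first m cells of the mesh: each cell adds an error of at most
    e/N, and m = N is the claim.\<close>
  have *: "\<bar>integral {0..m / N} g - (\<Sum>k<m. g (real k / real N)) / N\<bar> \<le> m * e / N" if "m \<le> N" for m
    using that
  proof (induction m)
    case (Suc m)
    have int: "g integrable_on {a..b}" if "0 \<le> a" "b \<le> 1" for a b
      by (rule integrable_continuous_real, rule continuous_on_subset[OF cont]) (use that in auto)
    have le: "Suc m / N \<le> 1" "real m / N \<le> Suc m / N" using Suc.prems \<open>N > 0\<close> by (auto simp: field_simps)
    have split: "integral {0..Suc m / N} g = integral {0..m / N} g + integral {m/N..Suc m / N} g"
      by (rule Henstock_Kurzweil_Integration.integral_combine[symmetric]) (use int le in auto)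
    have "\<bar>integral {m/N..Suc m/N} (\<lambda>x. g x - g (m / N))\<bar> \<le> e * (Suc m / N - m / N)"
    proof -
      have "norm (integral {m/N..Suc m/N} (\<lambda>x. g x - g (m / N))) \<le> e * (Suc m / N - m / N)"
      proof (rule integral_bound)
        show "continuous_on {m/N..Suc m/N} (\<lambda>x. g x - g (m / N))"
          by (intro continuous_intros continuous_on_subset[OF cont]) (use le in auto)
        show "norm (g t - g (m / N)) \<le> e" if "t \<in> {m/N..Suc m/N}" for t
        proof -
          have "\<bar>t - m / N\<bar> \<le> Suc m / N - m / N" using that by auto
          also have "\<dots> = 1 / N" by (simp add: add_divide_distrib)
          finally have *: "\<bar>t - m / N\<bar> \<le> 1 / N" .
          have "0 \<le> real m / N" by simp
          moreover from this have "0 \<le> t" using that by (meson atLeastAtMost_iff order_trans)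
          ultimately show ?thesis using osc[of t "m/N"] * that le by (simp del: of_nat_Suc)
        qed
      qed (use le in auto)
      thus ?thesis by simp
    qed
    moreover have "integral {m/N..Suc m/N} (\<lambda>x. g x - g (m / N)) = integral {m/N..Suc m/N} g - g (m/N) / N"
    proof -
      have "integral {m/N..Suc m/N} (\<lambda>x. g x - g (m / N)) = integral {m/N..Suc m/N} g - integral {m/N..Suc m/N} (\<lambda>x. g (m / N))"
        by (rule integral_diff) (use int[of "m/N" "Suc m/N"] le in auto)
      also have "integral {m/N..Suc m/N} (\<lambda>x. g (m / N)) = g (m/N) / N"
        using le by (simp add: diff_divide_distrib[symmetric] del: of_nat_Suc)
      finally show ?thesis .
    qed
    ultimately have "\<bar>integral {m/N..Suc m/N} g - g (m/N) / N\<bar> \<le> e / N" by (simp add: add_divide_distrib)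
    moreover have "\<bar>integral {0..m / N} g - (\<Sum>k<m. g (real k / real N)) / N\<bar> \<le> m * e / N" using Suc by simp
    ultimately show ?case unfolding split by (simp add: add_divide_distrib distrib_right distrib_left)
  qed (use assms in auto)
  from *[of N] show ?thesis using \<open>N > 0\<close> by simp
qed

text \<open>The circular mean is a uniform limit of averages of \<open>|f|^p\<close> over the rotations by \<open>N\<close>-th roots of
  unity, which obey the maximum principle; so no factorisation of zeros is needed.\<close>

lemma circle_mean_powr_mono:
  fixes f :: "complex \<Rightarrow> complex"
  assumes hol: "f holomorphic_on ball 0 \<rho>" and "p > 0" and ab: "cmod a \<le> cmod b" and b: "cmod b < \<rho>"
  shows "circle_mean (\<lambda>z. cmod (f z) powr p) a \<le> circle_mean (\<lambda>z. cmod (f z) powr p) b"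
proof (cases "b = 0")
  case False
  define R where "R = cmod b"
  have R: "R > 0" "R < \<rho>" using False b by (auto simp: R_def)
  define u where "u z = cmod (f z) powr p" for z
  have contf: "continuous_on (cball 0 R) f"
    by (rule continuous_on_subset[OF holomorphic_on_imp_continuous_on[OF hol]]) (use R in auto)
  have u: "continuous_on (cball 0 R) u" unfolding u_def
    using \<open>p > 0\<close> by (intro continuous_intros continuous_on_powr' contf) auto
  have "circle_mean u a \<le> circle_mean u b + 2 * e" if "e > 0" for e
  proof -
    have "uniformly_continuous_on (cball 0 R) u" using u by (simp add: compact_uniformly_continuous)
    then obtain d where d: "d > 0" "\<And>x y. x \<in> cball 0 R \<Longrightarrow> y \<in> cball 0 R \<Longrightarrow> dist x y < d \<Longrightarrow> \<bar>u x - u y\<bar> < e"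
      using \<open>e > 0\<close> unfolding uniformly_continuous_on_def dist_real_def by meson
    \<comment> \<open>One mesh step moves a point of modulus at most R by at most 2 pi R / N, which
      has to stay below the distance d given by uniform continuity.\<close>
    obtain N where N: "real N > 2 * pi * R / d" using reals_Archimedean2 by blast
    have Npos: "N > 0" 
    proof -
      have "0 < 2 * pi * R / d" using R d(1) by simp
      thus ?thesis using N by (simp only: of_nat_0_less_iff[where 'a=real, symmetric])
    qed
    define S where "S z = (\<Sum>k<N. u (cis (2 * pi * (real k / real N)) * z)) / N" for z
    have approx: "\<bar>circle_mean u z - S z\<bar> \<le> e" if z: "z \<in> cball 0 R" for z
      unfolding circle_mean_def S_def
    proof (rule riemann_sum_bound[OF Npos])
      show "continuous_on {0..1} (\<lambda>t. u (cis (2 * pi * t) * z))"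
        by (rule continuous_on_compose2[OF u]) (use z in \<open>auto intro!: continuous_intros simp: norm_mult\<close>)
      show "\<bar>u (cis (2 * pi * s) * z) - u (cis (2 * pi * t) * z)\<bar> \<le> e"
        if st: "s \<in> {0..1}" "t \<in> {0..1}" "\<bar>s - t\<bar> \<le> 1 / real N" for s t
      proof -
        have "dist (cis (2 * pi * s) * z) (cis (2 * pi * t) * z) = cmod (cis (2 * pi * s) - cis (2 * pi * t)) * cmod z"
          by (simp add: dist_norm norm_mult[symmetric] algebra_simps)
        also have "cmod (cis (2 * pi * s) - cis (2 * pi * t)) \<le> 2 * pi * \<bar>s - t\<bar>"
          using norm_cis_diff_le[of "2 * pi * s" "2 * pi * t"] by (simp add: abs_mult flip: right_diff_distrib)
        also have "2 * pi * \<bar>s - t\<bar> * cmod z \<le> 2 * pi * (1 / N) * R"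
          using st z R by (intro mult_mono) auto
        also have "\<dots> < d" using N Npos d(1) by (simp add: field_simps)
        finally have "dist (cis (2 * pi * s) * z) (cis (2 * pi * t) * z) < d" by (simp add: mult_right_mono)
        thus ?thesis using d(2)[of "cis (2 * pi * s) * z" "cis (2 * pi * t) * z"] z by (simp add: norm_mult)
      qed
    qed
    \<comment> \<open>The discrete mean S need not be constant on circles, so the maximum principle
      yields only some point w with |w| = R, not b itself. The full mean is constant on the circle
      and brings the estimate back to b.\<close>
    obtain w where w: "cmod w = R" "S a \<le> S w"
    proof (rule sum_powr_maximum_principle[of "{..<N}" p "\<lambda>k z. f (cis (2 * pi * (real k / real N)) * z)" R a])
      fix i :: nat
      show "(\<lambda>z. f (cis (2 * pi * (real i / real N)) * z)) holomorphic_on ball 0 R"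
        by (rule holomorphic_on_compose_gen[OF _ hol, unfolded o_def])
           (use R in \<open>auto intro!: holomorphic_intros simp: norm_mult\<close>)
      show "continuous_on (cball 0 R) (\<lambda>z. f (cis (2 * pi * (real i / real N)) * z))"
        by (rule continuous_on_compose2[OF contf]) (auto intro!: continuous_intros simp: norm_mult)
    next
      fix w assume "cmod w = R" "(\<Sum>i<N. cmod (f (cis (2 * pi * (real i / real N)) * a)) powr p) \<le> (\<Sum>i<N. cmod (f (cis (2 * pi * (real i / real N)) * w)) powr p)"
      thus thesis using that[of w] by (simp add: S_def u_def divide_right_mono)
    qed (use assms R ab in \<open>auto simp: R_def\<close>)
    have "circle_mean u w = circle_mean u b"
      using circle_mean_rotate[OF u, of b "w / b"] w False by (simp add: norm_divide R_def)
    thus ?thesis using w approx[of a] approx[of w] ab by (simp add: R_def)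
  qed
  from this[of "e / 2" for e] have "circle_mean u a \<le> circle_mean u b + e" if "e > 0" for e
    using that by simp
  hence "circle_mean u a \<le> circle_mean u b" using field_le_epsilon by blast
  thus ?thesis by (simp add: u_def[abs_def])
qed (use ab in auto)

subsection \<open>Rotation invariance and radially increasing functions\<close>

lemma nn_integral_lborel_translate:
  fixes f :: "'a::euclidean_space \<Rightarrow> ennreal"
  assumes [measurable]: "f \<in> borel_measurable borel"
  shows "(\<integral>\<^sup>+x. f (a + x) \<partial>lborel) = (\<integral>\<^sup>+x. f x \<partial>lborel)"
proof -
  have "(\<integral>\<^sup>+x. f x \<partial>lborel) = (\<integral>\<^sup>+x. f x \<partial>distr lborel borel ((+) a))"
    by (simp add: lborel_distr_plus)
  thus ?thesis by (simp add: nn_integral_distr)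
qed

text \<open>The argument is the uniqueness of Haar measure: the measure \<open>A \<mapsto> \<lambda>(c A)\<close> is translation
  invariant and has the right value on the unit disc.\<close>

lemma emeasure_lborel_rotate:
  fixes c :: complex
  assumes c: "cmod c = 1" and [measurable]: "A \<in> sets borel"
  shows "(\<integral>\<^sup>+y. indicator A (c * y) \<partial>lborel) = emeasure lborel A"
proof -
  \<comment> \<open>The calibrating set: it is invariant under multiplication by c, and its area is
    positive and finite, so that it can be cancelled.\<close>
  define B where "B = ball (0::complex) 1"
  have [measurable]: "B \<in> sets borel" by (simp add: B_def)
  have "c \<noteq> 0" using c by auto
  have B: "(\<integral>\<^sup>+y. indicator B (x - c * y) \<partial>lborel) = emeasure lborel B" for x
  proof -
    have "(\<integral>\<^sup>+y. indicator B (x - c * y) \<partial>lborel) = (\<integral>\<^sup>+y. indicator B (x - c * (x / c + y)) \<partial>lborel)"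
      by (rule nn_integral_lborel_translate[symmetric, where f = "\<lambda>y. indicator B (x - c * y)"]) simp
    also have "\<dots> = (\<integral>\<^sup>+y. indicator B y \<partial>lborel)"
      using \<open>c \<noteq> 0\<close> c by (intro nn_integral_cong) (auto simp: B_def indicator_def distrib_left norm_mult)
    finally show ?thesis by simp
  qed
  have A: "(\<integral>\<^sup>+y. indicator A (x + c * y) \<partial>lborel) = (\<integral>\<^sup>+y. indicator A (c * y) \<partial>lborel)" for x
  proof -
    have "(\<integral>\<^sup>+y. indicator A (c * y) \<partial>lborel) = (\<integral>\<^sup>+y. indicator A (c * (x / c + y)) \<partial>lborel)"
      by (rule nn_integral_lborel_translate[symmetric, where f = "\<lambda>y. indicator A (c * y)"]) simp
    thus ?thesis using \<open>c \<noteq> 0\<close> by (simp add: distrib_left)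
  qed
  \<comment> \<open>The double integral of 1_A(x) 1_B(x - c y) is evaluated in both orders.
    Integrating in y first gives |A| |B|; exchanging the order and shifting x by c y separates the
    factor |B| from the measure of the rotated set.\<close>
  have "emeasure lborel A * emeasure lborel B
      = (\<integral>\<^sup>+x. (\<integral>\<^sup>+y. indicator A x * indicator B (x - c * y) \<partial>lborel) \<partial>lborel)"
    by (simp add: nn_integral_cmult B nn_integral_multc)
  also have "\<dots> = (\<integral>\<^sup>+y. (\<integral>\<^sup>+x. indicator A x * indicator B (x - c * y) \<partial>lborel) \<partial>lborel)"
    by (rule lborel_pair.Fubini') measurable
  also have "\<dots> = (\<integral>\<^sup>+y. (\<integral>\<^sup>+x. indicator A (x + c * y) * indicator B x \<partial>lborel) \<partial>lborel)"
  proof (rule nn_integral_cong)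
    fix y :: complex
    show "(\<integral>\<^sup>+x. indicator A x * indicator B (x - c * y) \<partial>lborel)
        = (\<integral>\<^sup>+x. indicator A (x + c * y) * indicator B x \<partial>lborel)"
      using nn_integral_lborel_translate[of "\<lambda>x. indicator A x * indicator B (x - c * y)" "c * y"]
      by (simp add: add.commute)
  qed
  also have "\<dots> = (\<integral>\<^sup>+x. (\<integral>\<^sup>+y. indicator A (x + c * y) * indicator B x \<partial>lborel) \<partial>lborel)"
    by (rule lborel_pair.Fubini'[symmetric]) measurable
  also have "\<dots> = (\<integral>\<^sup>+y. indicator A (c * y) \<partial>lborel) * emeasure lborel B"
    by (simp add: nn_integral_multc A nn_integral_cmult)
  finally have eq: "emeasure lborel A * emeasure lborel B = (\<integral>\<^sup>+y. indicator A (c * y) \<partial>lborel) * emeasure lborel B" .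
  have "emeasure lborel B = ennreal pi"
    unfolding B_def by (simp add: emeasure_ball unit_ball_vol_2)
  hence "emeasure lborel B \<noteq> 0" "emeasure lborel B \<noteq> top" using pi_gt_zero by (auto simp: ennreal_eq_0_iff simp del: pi_gt_zero)
  thus ?thesis using eq by (auto simp: mult.commute[of _ "emeasure lborel B"] ennreal_mult_cancel_left)
qed

lemma nn_integral_lborel_rotate:
  fixes c :: complex
  assumes c: "cmod c = 1" and [measurable]: "f \<in> borel_measurable borel"
  shows "(\<integral>\<^sup>+y. f (c * y) \<partial>lborel) = (\<integral>\<^sup>+y. f y \<partial>lborel)"
proof -
  have "distr lborel borel ((*) c) = lborel"
  proof (rule measure_eqI)
    fix A assume "A \<in> sets (distr lborel borel ((*) c))"
    hence [measurable]: "A \<in> sets borel" by simp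
    have "emeasure (distr lborel borel ((*) c)) A = (\<integral>\<^sup>+y. indicator A y \<partial>distr lborel borel ((*) c))" by simp
    also have "\<dots> = (\<integral>\<^sup>+y. indicator A (c * y) \<partial>lborel)" by (rule nn_integral_distr) measurable
    finally show "emeasure (distr lborel borel ((*) c)) A = emeasure lborel A"
      using emeasure_lborel_rotate[OF c] by simp
  qed simp
  hence "(\<integral>\<^sup>+y. f y \<partial>lborel) = (\<integral>\<^sup>+y. f y \<partial>distr lborel borel ((*) c))" by simp
  also have "\<dots> = (\<integral>\<^sup>+y. f (c * y) \<partial>lborel)" by (rule nn_integral_distr) measurable
  finally show ?thesis by simp
qed

text \<open>The \<open>ennreal\<close> counterpart of \<open>circle_mean\<close>: it is Borel for
  every Borel u and fits into Tonelli's theorem. For nonnegative continuous functions the two agree,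
  which is how monotonicity is inherited.\<close>

definition rotation_mean :: "(complex \<Rightarrow> ennreal) \<Rightarrow> complex \<Rightarrow> ennreal" where
  "rotation_mean u z = (\<integral>\<^sup>+t\<in>{0..1}. u (cis (2 * pi * t) * z) \<partial>lborel)"

lemma measurable_rotation: "(\<lambda>(t, z). cis (2 * pi * t) * z) \<in> borel \<Otimes>\<^sub>M borel \<rightarrow>\<^sub>M borel"
  unfolding borel_prod
  by (intro borel_measurable_continuous_onI) (auto simp: case_prod_unfold intro!: continuous_intros)

lemma measurable_rotation_mean [measurable]:
  assumes [measurable]: "u \<in> borel_measurable borel"
  shows "rotation_mean u \<in> borel_measurable borel"
proof -
  note measurable_rotation[measurable]
  have "(\<lambda>(z, t). u (cis (2 * pi * t) * z) * indicator {0..1} t) \<in> borel_measurable (borel \<Otimes>\<^sub>M lborel)"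
    using measurable_compose[OF measurable_compose[OF measurable_pair_swap' measurable_rotation] assms]
    by (simp add: case_prod_unfold measurable_lborel1 cong: measurable_cong_sets)
  thus ?thesis unfolding rotation_mean_def[abs_def]
    by (intro lborel.borel_measurable_nn_integral) (simp add: case_prod_unfold)
qed

text \<open>For each fixed t the rotation preserves both \<open>lborel\<close> and \<psi>, so after
  exchanging the integrals every t in [0,1] contributes the same amount. This is what licenses the
  passage from |f|^p to its means, and back.\<close>

lemma nn_integral_mult_radial:
  fixes u \<psi> :: "complex \<Rightarrow> ennreal"
  assumes [measurable]: "u \<in> borel_measurable borel" "\<psi> \<in> borel_measurable borel"
    and rad: "\<And>c z. cmod c = 1 \<Longrightarrow> \<psi> (c * z) = \<psi> z"
  shows "(\<integral>\<^sup>+z. rotation_mean u z * \<psi> z \<partial>lborel) = (\<integral>\<^sup>+z. u z * \<psi> z \<partial>lborel)"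
proof -
  have [measurable]: "(\<lambda>x. u (cis (2 * pi * snd x) * fst x)) \<in> borel_measurable (borel \<Otimes>\<^sub>M borel)"
    using measurable_compose[OF measurable_compose[OF measurable_pair_swap' measurable_rotation] assms(1)]
    by (simp add: case_prod_unfold)
  have [measurable]: "(\<lambda>z. u (cis (2 * pi * t) * z)) \<in> borel_measurable borel" for t
    by measurable
  have [measurable]: "(\<lambda>t. u (cis (2 * pi * t) * z)) \<in> borel_measurable borel" for z
    using measurable_compose[OF measurable_Pair1'[of z borel borel] \<open>(\<lambda>x. u (cis (2 * pi * snd x) * fst x)) \<in> _\<close>] by simp
  have "(\<integral>\<^sup>+z. rotation_mean u z * \<psi> z \<partial>lborel)
      = (\<integral>\<^sup>+z. (\<integral>\<^sup>+t. u (cis (2 * pi * t) * z) * indicator {0..1} t * \<psi> z \<partial>lborel) \<partial>lborel)"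
    unfolding rotation_mean_def by (subst nn_integral_multc) auto
  also have "\<dots> = (\<integral>\<^sup>+t. (\<integral>\<^sup>+z. u (cis (2 * pi * t) * z) * indicator {0..1} t * \<psi> z \<partial>lborel) \<partial>lborel)"
    by (rule lborel_pair.Fubini'[symmetric]) (simp add: case_prod_unfold)
  also have "\<dots> = (\<integral>\<^sup>+t. indicator {0..1::real} t * (\<integral>\<^sup>+z. u z * \<psi> z \<partial>lborel) \<partial>lborel)"
  proof (rule nn_integral_cong)
    fix t :: real
    have "(\<integral>\<^sup>+z. u (cis (2 * pi * t) * z) * indicator {0..1} t * \<psi> z \<partial>lborel)
        = (\<integral>\<^sup>+z. indicator {0..1} t * (u (cis (2 * pi * t) * z) * \<psi> (cis (2 * pi * t) * z)) \<partial>lborel)"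
      using rad[of "cis (2 * pi * t)"] by (intro nn_integral_cong) (simp add: mult_ac)
    also have "\<dots> = indicator {0..1} t * (\<integral>\<^sup>+z. u (cis (2 * pi * t) * z) * \<psi> (cis (2 * pi * t) * z) \<partial>lborel)"
      by (rule nn_integral_cmult) measurable
    also have "(\<integral>\<^sup>+z. u (cis (2 * pi * t) * z) * \<psi> (cis (2 * pi * t) * z) \<partial>lborel) = (\<integral>\<^sup>+z. u z * \<psi> z \<partial>lborel)"
      by (rule nn_integral_lborel_rotate[where f = "\<lambda>z. u z * \<psi> z"]) auto
    finally show "(\<integral>\<^sup>+z. u (cis (2 * pi * t) * z) * indicator {0..1} t * \<psi> z \<partial>lborel)
        = indicator {0..1} t * (\<integral>\<^sup>+z. u z * \<psi> z \<partial>lborel)" .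
  qed
  also have "\<dots> = (\<integral>\<^sup>+z. u z * \<psi> z \<partial>lborel)"
    by (subst nn_integral_multc) auto
  finally show ?thesis .
qed

lemma rotation_mean_eq_circle_mean:
  fixes v :: "complex \<Rightarrow> real"
  assumes cont: "continuous_on (ball 0 \<rho>) v" and pos: "\<And>z. v z \<ge> 0" and z: "cmod z < \<rho>"
  shows "rotation_mean (\<lambda>z. ennreal (v z) * indicator (ball 0 \<rho>) z) z = ennreal (circle_mean v z)"
proof -
  define g where "g t = v (cis (2 * pi * t) * z)" for t
  have g: "continuous_on UNIV g" unfolding g_def
    by (rule continuous_on_compose2[OF cont]) (use z in \<open>auto intro!: continuous_intros simp: norm_mult\<close>)
  hence [measurable]: "g \<in> borel_measurable borel" by (rule borel_measurable_continuous_onI)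
  have "(g has_integral circle_mean v z) {0..1}"
    unfolding circle_mean_def g_def[symmetric]
    by (intro integrable_integral integrable_continuous_real continuous_on_subset[OF g]) auto
  hence "((\<lambda>t. g t * indicator {0..1} t) has_integral circle_mean v z) UNIV"
    using has_integral_restrict_UNIV[of "{0..1}" g] by (simp add: indicator_def of_bool_def if_distrib cong: if_cong)
  hence "(\<integral>\<^sup>+t. ennreal (g t * indicator {0..1} t) \<partial>lborel) = ennreal (circle_mean v z)"
    by (rule nn_integral_has_integral_lborel[rotated 2]) (measurable, simp add: g_def pos)
  moreover have "rotation_mean (\<lambda>z. ennreal (v z) * indicator (ball 0 \<rho>) z) z = (\<integral>\<^sup>+t. ennreal (g t * indicator {0..1} t) \<partial>lborel)"
    unfolding rotation_mean_def g_def using z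
    by (intro nn_integral_cong) (auto simp: indicator_def norm_mult)
  ultimately show ?thesis by simp
qed

lemma borel_measurable_continuous_on_times_indicator:
  fixes v :: "'a::topological_space \<Rightarrow> real"
  assumes "continuous_on A v" "A \<in> sets borel"
  shows "(\<lambda>z. ennreal (v z) * indicator A z) \<in> borel_measurable borel"
proof -
  have "(\<lambda>z. indicator A z *\<^sub>R v z) \<in> borel_measurable borel"
    using borel_measurable_continuous_on_indicator[OF assms(2,1)] .
  hence "(\<lambda>z. ennreal (indicator A z *\<^sub>R v z)) \<in> borel_measurable borel" by measurable
  also have "(\<lambda>z. ennreal (indicator A z *\<^sub>R v z)) = (\<lambda>z. ennreal (v z) * indicator A z)"
    by (auto simp: indicator_def)
  finally show ?thesis .
qed

lemma rotation_mean_powr_mono: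
  fixes f :: "complex \<Rightarrow> complex" and \<rho> p :: real
  defines "u \<equiv> (\<lambda>z. ennreal (cmod (f z) powr p) * indicator (ball 0 \<rho>) z)"
  assumes hol: "f holomorphic_on ball 0 \<rho>" and "p > 0" and ab: "cmod a \<le> cmod b" "cmod b < \<rho>"
  shows "rotation_mean u a \<le> rotation_mean u b"
proof -
  have cont: "continuous_on (ball 0 \<rho>) (\<lambda>z. cmod (f z) powr p)"
    using \<open>p > 0\<close> holomorphic_on_imp_continuous_on[OF hol]
    by (intro continuous_intros continuous_on_powr') auto
  show ?thesis unfolding u_def using ab circle_mean_powr_mono[OF hol \<open>p > 0\<close> ab]
    by (simp add: rotation_mean_eq_circle_mean[OF cont] ennreal_leI)
qed

text \<open>After translating a to 0, the mean at 0 is |f(a)|^p and is at most the mean on every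
  larger circle; integrating over the disc removes the means again. The constant is 1 for every p,
  which keeps the final constant independent of p.\<close>

lemma holomorphic_powr_submean:
  fixes f :: "complex \<Rightarrow> complex"
  assumes hol: "f holomorphic_on ball a s" and "p > 0" and "s > 0"
  shows "ennreal (cmod (f a) powr p) * ennreal (pi * s\<^sup>2) \<le> (\<integral>\<^sup>+z\<in>ball a s. ennreal (cmod (f z) powr p) \<partial>lborel)"
proof -
  define g where "g z = f (a + z)" for z
  have g: "g holomorphic_on ball 0 s" unfolding g_def
    by (rule holomorphic_on_compose_gen[OF _ hol, unfolded o_def]) (auto intro!: holomorphic_intros simp: dist_norm)
  have contf: "continuous_on (ball a s) (\<lambda>z. cmod (f z) powr p)"
    using \<open>p > 0\<close> holomorphic_on_imp_continuous_on[OF hol]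
    by (intro continuous_intros continuous_on_powr') auto
  have cont: "continuous_on (ball 0 s) (\<lambda>z. cmod (g z) powr p)"
    using \<open>p > 0\<close> holomorphic_on_imp_continuous_on[OF g]
    by (intro continuous_intros continuous_on_powr') auto
  define u where "u z = ennreal (cmod (g z) powr p) * indicator (ball 0 s) z" for z
  have [measurable]: "u \<in> borel_measurable borel"
    unfolding u_def[abs_def] by (rule borel_measurable_continuous_on_times_indicator[OF cont]) simp
  have u0: "rotation_mean u 0 = ennreal (cmod (f a) powr p)"
    unfolding rotation_mean_def using \<open>s > 0\<close> by (simp add: u_def g_def nn_integral_cmult)
  have "ennreal (cmod (f a) powr p) * ennreal (pi * s\<^sup>2) = (\<integral>\<^sup>+z. ennreal (cmod (f a) powr p) * indicator (ball (0::complex) s) z \<partial>lborel)"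
    by (subst nn_integral_cmult_indicator) (use \<open>s > 0\<close> in \<open>simp_all add: emeasure_ball unit_ball_vol_2\<close>)
  also have "\<dots> \<le> (\<integral>\<^sup>+z. rotation_mean u z * indicator (ball 0 s) z \<partial>lborel)"
  proof (rule nn_integral_mono)
    fix z :: complex
    have "rotation_mean u 0 \<le> rotation_mean u z" if "cmod z < s"
      unfolding u_def[abs_def] by (rule rotation_mean_powr_mono[OF g \<open>p > 0\<close>]) (use that in auto)
    thus "ennreal (cmod (f a) powr p) * indicator (ball 0 s) z \<le> rotation_mean u z * indicator (ball 0 s) z"
      by (auto simp: u0 indicator_def)
  qed
  also have "\<dots> = (\<integral>\<^sup>+z. u z * indicator (ball 0 s) z \<partial>lborel)"
    by (rule nn_integral_mult_radial) (auto simp: indicator_def norm_mult)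
  also have "\<dots> = (\<integral>\<^sup>+z. (\<lambda>z. ennreal (cmod (f z) powr p) * indicator (ball a s) z) (a + z) \<partial>lborel)"
    by (intro nn_integral_cong) (auto simp: u_def g_def indicator_def dist_norm)
  also have "\<dots> = (\<integral>\<^sup>+z. ennreal (cmod (f z) powr p) * indicator (ball a s) z \<partial>lborel)"
    by (rule nn_integral_lborel_translate) (rule borel_measurable_continuous_on_times_indicator[OF contf], simp)
  finally show ?thesis .
qed

section \<open>Layer-cake comparison for radially increasing functions\<close>

lemma nn_integral_layer_cake:
  "x = (\<integral>\<^sup>+\<tau>. indicator {\<tau>. 0 \<le> \<tau> \<and> ennreal \<tau> < x} \<tau> \<partial>lborel)"
proof (cases x)
  case (real r)
  hence "{\<tau>. 0 \<le> \<tau> \<and> ennreal \<tau> < x} = {0..<r}" by (auto simp: ennreal_less_iff)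
  thus ?thesis using real by simp
next
  case top
  hence "{\<tau>. 0 \<le> \<tau> \<and> ennreal \<tau> < x} = {0..}" by auto
  moreover have "emeasure lborel {0::real..} = top"
  proof -
    have "of_nat n \<le> emeasure lborel {0::real..}" for n
      using emeasure_mono[of "{0..real n}" "{0..}" lborel] by (simp add: ennreal_of_nat_eq_real_of_nat)
    hence "(SUP n. of_nat n) \<le> emeasure lborel {0::real..}" by (rule SUP_least)
    thus ?thesis by (simp add: ennreal_SUP_of_nat_eq_top top_unique)
  qed
  ultimately show ?thesis using top by simp
qed

lemma nn_integral_layer_cake_mult:
  fixes U \<psi> :: "complex \<Rightarrow> ennreal"
  assumes [measurable]: "U \<in> borel_measurable borel" "\<psi> \<in> borel_measurable borel"
  shows "(\<integral>\<^sup>+z. U z * \<psi> z \<partial>lborel)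
    = (\<integral>\<^sup>+\<tau>. (\<integral>\<^sup>+z. indicator {(z, \<tau>). 0 \<le> \<tau> \<and> ennreal \<tau> < U z} (z, \<tau>) * \<psi> z \<partial>lborel) \<partial>lborel)"
proof -
  have [measurable]: "{(z, \<tau>). 0 \<le> \<tau> \<and> ennreal \<tau> < U z} \<in> sets (lborel \<Otimes>\<^sub>M lborel)"
  proof -
    have "{x \<in> space (lborel \<Otimes>\<^sub>M lborel). 0 \<le> snd x \<and> ennreal (snd x) < U (fst x)} \<in> sets (lborel \<Otimes>\<^sub>M lborel)"
      by measurable
    thus ?thesis by (simp add: space_pair_measure case_prod_unfold)
  qed
  have "(\<integral>\<^sup>+z. U z * \<psi> z \<partial>lborel)
    = (\<integral>\<^sup>+z. (\<integral>\<^sup>+\<tau>. indicator {(z, \<tau>). 0 \<le> \<tau> \<and> ennreal \<tau> < U z} (z, \<tau>) * \<psi> z \<partial>lborel) \<partial>lborel)"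
  proof (rule nn_integral_cong)
    fix z
    have "U z * \<psi> z = (\<integral>\<^sup>+\<tau>. indicator {\<tau>. 0 \<le> \<tau> \<and> ennreal \<tau> < U z} \<tau> \<partial>lborel) * \<psi> z"
      using nn_integral_layer_cake[of "U z"] by simp
    also have "\<dots> = (\<integral>\<^sup>+\<tau>. indicator {\<tau>. 0 \<le> \<tau> \<and> ennreal \<tau> < U z} \<tau> * \<psi> z \<partial>lborel)"
      by (rule nn_integral_multc[symmetric]) measurable
    finally show "U z * \<psi> z = (\<integral>\<^sup>+\<tau>. indicator {(z, \<tau>). 0 \<le> \<tau> \<and> ennreal \<tau> < U z} (z, \<tau>) * \<psi> z \<partial>lborel)"
      by (simp add: indicator_def)
  qed
  also have "\<dots> = (\<integral>\<^sup>+\<tau>. (\<integral>\<^sup>+z. indicator {(z, \<tau>). 0 \<le> \<tau> \<and> ennreal \<tau> < U z} (z, \<tau>) * \<psi> z \<partial>lborel) \<partial>lborel)"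
    by (rule lborel_pair.Fubini'[symmetric]) measurable
  finally show ?thesis .
qed

text \<open>By the layer-cake formula it suffices to treat one superlevel set of U. If nonempty in
  the disc, it lies between the annuli t < |z| < 1 and t \<le> |z| < 1, where t is the infimum of
  the moduli in it. Whether the inner circle belongs to it is unknown, hence the closed annulus on
  the left of \<open>tail\<close> and the open one on the right.\<close>

lemma nn_integral_radially_increasing_le:
  fixes U \<psi> \<phi> :: "complex \<Rightarrow> ennreal" and K :: ennreal
  assumes [measurable]: "U \<in> borel_measurable borel" "\<psi> \<in> borel_measurable borel" "\<phi> \<in> borel_measurable borel"
    and mono: "\<And>a b. cmod a \<le> cmod b \<Longrightarrow> cmod b < 1 \<Longrightarrow> U a \<le> U b"
    and tail: "\<And>t. 0 \<le> t \<Longrightarrow> t < 1 \<Longrightarrow>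
      (\<integral>\<^sup>+z\<in>{z. t \<le> cmod z \<and> cmod z < 1}. \<psi> z \<partial>lborel) \<le> K * (\<integral>\<^sup>+z\<in>{z. t < cmod z \<and> cmod z < 1}. \<phi> z \<partial>lborel)"
  shows "(\<integral>\<^sup>+z\<in>ball 0 1. U z * \<psi> z \<partial>lborel) \<le> K * (\<integral>\<^sup>+z\<in>ball 0 1. U z * \<phi> z \<partial>lborel)"
proof -
  have [measurable]: "ball (0::complex) 1 \<in> sets borel" by simp
  define L where "L = {(z, \<tau>). 0 \<le> \<tau> \<and> ennreal \<tau> < U z}"
  have L: "(\<integral>\<^sup>+z. U z * (\<eta> z * indicator (ball 0 1) z) \<partial>lborel)
    = (\<integral>\<^sup>+\<tau>. (\<integral>\<^sup>+z. indicator L (z, \<tau>) * (\<eta> z * indicator (ball 0 1) z) \<partial>lborel) \<partial>lborel)"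
    if [measurable]: "\<eta> \<in> borel_measurable borel" for \<eta> :: "complex \<Rightarrow> ennreal"
    unfolding L_def by (rule nn_integral_layer_cake_mult) measurable
  have [measurable]: "L \<in> sets (borel \<Otimes>\<^sub>M borel)"
  proof -
    have "{x \<in> space (borel \<Otimes>\<^sub>M borel). 0 \<le> snd x \<and> ennreal (snd x) < U (fst x)} \<in> sets (borel \<Otimes>\<^sub>M borel)"
      by measurable
    thus ?thesis by (simp add: space_pair_measure case_prod_unfold L_def)
  qed
  have *: "(\<integral>\<^sup>+z. indicator L (z, \<tau>) * (\<psi> z * indicator (ball 0 1) z) \<partial>lborel)
      \<le> K * (\<integral>\<^sup>+z. indicator L (z, \<tau>) * (\<phi> z * indicator (ball 0 1) z) \<partial>lborel)" for \<tau>
  proof (cases "\<exists>z. cmod z < 1 \<and> (z, \<tau>) \<in> L")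
    case False
    hence "(\<integral>\<^sup>+z. indicator L (z, \<tau>) * (\<psi> z * indicator (ball 0 1) z) \<partial>lborel) = (\<integral>\<^sup>+z. 0 \<partial>(lborel :: complex measure))"
      by (intro nn_integral_cong) (auto simp: indicator_def)
    thus ?thesis by simp
  next
    case True
    define T where "T = cmod ` {z. cmod z < 1 \<and> (z, \<tau>) \<in> L}"
    have T: "T \<noteq> {}" "bdd_below T" using True by (auto simp: T_def intro!: bdd_belowI[of _ 0])
    define t where "t = Inf T"
    have t0: "0 \<le> t" unfolding t_def using T by (intro cInf_greatest) (auto simp: T_def)
    have t_le: "t \<le> cmod z" if "cmod z < 1" "(z, \<tau>) \<in> L" for z
      unfolding t_def using that T by (intro cInf_lower) (auto simp: T_def)
    have t1: "t < 1" using True t_le by force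
    \<comment> \<open>Since t is an infimum, some point of the level set has smaller modulus than z;
      monotonicity carries membership outwards to z.\<close>
    have in_L: "(z, \<tau>) \<in> L" if "t < cmod z" "cmod z < 1" for z
    proof -
      obtain y where y: "cmod y < cmod z" "(y, \<tau>) \<in> L"
        using \<open>t < cmod z\<close> T unfolding t_def by (auto simp: cInf_less_iff T_def)
      thus ?thesis using mono[of y z] that by (auto simp: L_def intro: less_le_trans)
    qed
    have "(\<integral>\<^sup>+z. indicator L (z, \<tau>) * (\<psi> z * indicator (ball 0 1) z) \<partial>lborel)
        \<le> (\<integral>\<^sup>+z\<in>{z. t \<le> cmod z \<and> cmod z < 1}. \<psi> z \<partial>lborel)"
      by (intro nn_integral_mono) (auto simp: indicator_def t_le)
    also have "\<dots> \<le> K * (\<integral>\<^sup>+z\<in>{z. t < cmod z \<and> cmod z < 1}. \<phi> z \<partial>lborel)"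
      by (rule tail[OF t0 t1])
    also have "(\<integral>\<^sup>+z\<in>{z. t < cmod z \<and> cmod z < 1}. \<phi> z \<partial>lborel) \<le> (\<integral>\<^sup>+z. indicator L (z, \<tau>) * (\<phi> z * indicator (ball 0 1) z) \<partial>lborel)"
      by (intro nn_integral_mono) (auto simp: indicator_def in_L)
    finally show ?thesis by (simp add: mult_left_mono)
  qed
  have "(\<integral>\<^sup>+z\<in>ball 0 1. U z * \<psi> z \<partial>lborel)
      = (\<integral>\<^sup>+\<tau>. (\<integral>\<^sup>+z. indicator L (z, \<tau>) * (\<psi> z * indicator (ball 0 1) z) \<partial>lborel) \<partial>lborel)"
    using L[of \<psi>] by (simp add: mult.assoc)
  also have "\<dots> \<le> (\<integral>\<^sup>+\<tau>. K * (\<integral>\<^sup>+z. indicator L (z, \<tau>) * (\<phi> z * indicator (ball 0 1) z) \<partial>lborel) \<partial>lborel)"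
    by (rule nn_integral_mono) (rule *)
  also have "\<dots> = K * (\<integral>\<^sup>+\<tau>. (\<integral>\<^sup>+z. indicator L (z, \<tau>) * (\<phi> z * indicator (ball 0 1) z) \<partial>lborel) \<partial>lborel)"
    by (rule nn_integral_cmult) measurable
  also have "\<dots> = K * (\<integral>\<^sup>+z\<in>ball 0 1. U z * \<phi> z \<partial>lborel)"
    using L[of \<phi>] by (simp add: mult.assoc)
  finally show ?thesis .
qed

subsection \<open>Radial weights\<close>

text \<open>Polar coordinates for radial functions, derived from the area of discs alone: both
  measures are finite on the half-lines above x and agree there, which determines them.\<close>

lemma distr_cmod_disc:
  "distr (density lborel (indicator (ball (0::complex) 1))) borel cmod
    = density lborel (\<lambda>s. ennreal (2 * pi * s) * indicator {0..<1} s)" (is "?M = ?N")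
proof (rule measure_eqI_lessThan)
  \<comment> \<open>y is x clamped to [0,1]; the points of the disc with modulus above x fill, up to
    a null set, the annulus y < |z| < 1.\<close>
  have eq: "emeasure ?M {x<..} = ennreal (pi - pi * y\<^sup>2) \<and> emeasure ?N {x<..} = ennreal (pi - pi * y\<^sup>2)"
    if y: "y = min 1 (max x 0)" for x y :: real
  proof
    have [measurable]: "ball (0::complex) 1 \<in> sets borel" by simp
    have area: "emeasure lborel (ball (0::complex) s) = ennreal (pi * s\<^sup>2)"
      "emeasure lborel (cball (0::complex) s) = ennreal (pi * s\<^sup>2)" if "s \<ge> 0" for s
      using that by (simp_all add: emeasure_ball emeasure_cball unit_ball_vol_2)
    have "emeasure ?M {x<..} = emeasure lborel (ball 0 1 \<inter> (cmod -` {x<..}))"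
    proof -
      have [measurable]: "cmod -` {x<..} \<in> sets borel"
        by (intro borel_open open_vimage continuous_intros)
      have "emeasure ?M {x<..} = emeasure (density lborel (indicator (ball 0 1))) (cmod -` {x<..})"
        by (subst emeasure_distr) auto
      also have "\<dots> = (\<integral>\<^sup>+z. indicator (ball 0 1) z * indicator (cmod -` {x<..}) z \<partial>lborel)"
        by (rule emeasure_density) auto
      also have "\<dots> = (\<integral>\<^sup>+z. indicator (ball 0 1 \<inter> (cmod -` {x<..})) z \<partial>lborel)"
        by (simp add: indicator_inter_arith)
      also have "\<dots> = emeasure lborel (ball 0 1 \<inter> (cmod -` {x<..}))"
        by (rule nn_integral_indicator) measurable
      finally show ?thesis .
    qed
    also have "\<dots> = ennreal (pi - pi * y\<^sup>2)"
    proof -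
      consider "x < 0" | "0 \<le> x" "x \<le> 1" | "1 < x" by linarith
      thus ?thesis
      proof cases
        case 1
        hence "ball (0::complex) 1 \<inter> (cmod -` {x<..}) = ball 0 1" by (auto intro: less_le_trans[OF _ norm_ge_zero])
        thus ?thesis using 1 y area(1)[of 1] by simp
      next
        case 2
        hence set: "ball (0::complex) 1 \<inter> (cmod -` {x<..}) = ball 0 1 - cball 0 x" by auto
        show ?thesis
        proof (cases "x = 1")
          case True
          have "ball (0::complex) 1 - cball 0 1 = {}" by auto
          thus ?thesis using True y unfolding set by (simp only:) simp
        next
          case False
          hence "cball (0::complex) x \<subseteq> ball 0 1" using 2 by auto
          hence "emeasure lborel (ball (0::complex) 1 - cball 0 x) = ennreal pi - ennreal (pi * x\<^sup>2)"
            using 2 area(1)[of 1] area(2)[of x] by (subst emeasure_Diff) auto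
          thus ?thesis using 2 set y by (simp add: ennreal_minus)
        qed
      next
        case 3
        hence "ball (0::complex) 1 \<inter> (cmod -` {x<..}) = {}" by auto
        thus ?thesis using 3 y by simp
      qed
    qed
    finally show "emeasure ?M {x<..} = ennreal (pi - pi * y\<^sup>2)" .
    have "emeasure ?N {x<..} = (\<integral>\<^sup>+s. ennreal (2 * pi * s) * indicator {0..<1} s * indicator {x<..} s \<partial>lborel)"
      by (rule emeasure_density) auto
    also have "\<dots> = (\<integral>\<^sup>+s. ennreal (2 * pi * s) * indicator {y..1} s \<partial>lborel)"
    proof (rule nn_integral_cong_AE)
      show "AE s in lborel. ennreal (2 * pi * s) * indicator {0..<1} s * indicator {x<..} s
          = ennreal (2 * pi * s) * indicator {y..1} s"
        using AE_lborel_singleton[of 1] AE_lborel_singleton[of x] AE_lborel_singleton[of 0]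
        by eventually_elim (auto simp: y indicator_def)
    qed
    also have "\<dots> = ennreal (pi * 1\<^sup>2 - pi * y\<^sup>2)"
      using y by (intro nn_integral_FTC_Icc) (auto intro!: derivative_eq_intros)
    finally show "emeasure ?N {x<..} = ennreal (pi - pi * y\<^sup>2)" by simp
  qed
  show "emeasure ?M {x<..} < \<infinity>" "emeasure ?M {x<..} = emeasure ?N {x<..}" for x
    using eq[OF refl, of x] by auto
qed auto

lemma nn_integral_radial_disc:
  fixes F :: "real \<Rightarrow> ennreal"
  assumes [measurable]: "F \<in> borel_measurable borel"
  shows "(\<integral>\<^sup>+z\<in>ball (0::complex) 1. F (cmod z) \<partial>lborel) = (\<integral>\<^sup>+s\<in>{0..<1}. F s * ennreal (2 * pi * s) \<partial>lborel)"
proof -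
  have [measurable]: "ball (0::complex) 1 \<in> sets borel" by simp
  have "(\<integral>\<^sup>+z\<in>ball (0::complex) 1. F (cmod z) \<partial>lborel)
      = (\<integral>\<^sup>+s. F s \<partial>distr (density lborel (indicator (ball (0::complex) 1))) borel cmod)"
    by (simp add: nn_integral_distr nn_integral_density mult.commute)
  also have "\<dots> = (\<integral>\<^sup>+s\<in>{0..<1}. F s * ennreal (2 * pi * s) \<partial>lborel)"
    by (simp add: distr_cmod_disc nn_integral_density mult_ac)
  finally show ?thesis .
qed

section \<open>Null sets and measurability on the disc and along a radius\<close>

lemma null_sets_radial_iff:
  assumes [measurable]: "R \<in> sets borel" and "R \<subseteq> {0..<1}"
  shows "R \<in> null_sets lborel \<longleftrightarrow> {z::complex. cmod z \<in> R} \<in> null_sets lborel"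
proof -
  have ball: "cmod z \<in> R \<Longrightarrow> z \<in> ball 0 1" for z :: complex using assms(2) by auto
  have meas: "{z::complex. cmod z \<in> R} \<in> sets borel" by measurable
  have "emeasure lborel {z::complex. cmod z \<in> R} = (\<integral>\<^sup>+z. indicator {z::complex. cmod z \<in> R} z \<partial>lborel)"
    using meas by simp
  also have "\<dots> = (\<integral>\<^sup>+z\<in>ball (0::complex) 1. indicator R (cmod z) \<partial>lborel)"
    by (intro nn_integral_cong) (use ball in \<open>auto simp: indicator_def\<close>)
  also have "\<dots> = (\<integral>\<^sup>+s\<in>{0..<1}. indicator R s * ennreal (2 * pi * s) \<partial>lborel)"
    by (rule nn_integral_radial_disc) measurable
  finally have eq: "emeasure lborel {z::complex. cmod z \<in> R} = \<dots>" .
  have "{z::complex. cmod z \<in> R} \<in> null_sets lborel \<longleftrightarrow> emeasure lborel {z::complex. cmod z \<in> R} = 0"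
    using meas by (simp add: null_sets_def)
  also have "\<dots> \<longleftrightarrow> (AE s in lborel. indicator R s * ennreal (2 * pi * s) * indicator {0..<1} s = 0)"
    unfolding eq by (subst nn_integral_0_iff_AE) auto
  \<comment> \<open>On [0,1) the density 2 pi s vanishes only at s = 0, a single point and hence
    null.\<close>
  also have "\<dots> \<longleftrightarrow> (AE s in lborel. s \<notin> R)"
  proof
    assume *: "AE s in lborel. indicator R s * ennreal (2 * pi * s) * indicator {0..<1} s = 0"
    show "AE s in lborel. s \<notin> R"
      using * AE_lborel_singleton[of 0]
    proof eventually_elim
      case (elim s)
      have False if "s \<in> R"
      proof -
        have "0 < s" "s < 1" using that elim(2) assms(2) by (force simp: subset_iff)+
        hence "indicator R s * ennreal (2 * pi * s) * indicator {0..<1} s = ennreal (2 * pi * s)" "2 * pi * s > 0"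
          using that by auto
        moreover have "ennreal (2 * pi * s) = 0" using elim(1) calculation(1) by (rule trans[OF sym, rotated])
        ultimately show False unfolding ennreal_eq_0_iff by linarith
      qed
      thus ?case by blast
    qed
  qed (erule AE_mp, auto simp: indicator_def)
  also have "\<dots> \<longleftrightarrow> R \<in> null_sets lborel" by (simp add: AE_iff_null_sets)
  finally show ?thesis by blast
qed

text \<open>Both the radial set and its complement in the disc are, up to null sets, countable unions of
  compact sets; their images under the modulus are Borel sets that exhaust \<open>[0,1)\<close> up to a null set.\<close>

lemma lebesgue_radial_sets:
  assumes A: "A \<subseteq> {0..<1}" and S: "{z::complex. cmod z \<in> A} \<in> sets lebesgue"
  shows "A \<in> sets lebesgue"
proof -
  have inner: "\<exists>K. K \<in> sets borel \<and> K \<subseteq> B \<and> {z::complex. cmod z \<in> B - K} \<in> null_sets lebesgue"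
    if B: "{z::complex. cmod z \<in> B} \<in> sets lebesgue" for B
  proof -
    obtain C T where CT: "fsigma C" "T \<in> null_sets lebesgue" "C \<union> T = {z::complex. cmod z \<in> B}" "disjnt C T"
      using lebesgue_set_almost_fsigma[OF B] .
    obtain F :: "nat \<Rightarrow> complex set" where F: "range F \<subseteq> Collect compact" "C = \<Union>(F ` UNIV)"
      using CT(1) fsigma_Union_compact by metis
    define K where "K = cmod ` C"
    have "compact (cmod ` F n)" for n using F(1) by (intro compact_continuous_image continuous_intros) auto
    hence "cmod ` F n \<in> sets borel" for n by (rule borel_compact)
    moreover have "K = (\<Union>n. cmod ` F n)" using F(2) by (auto simp: K_def)
    ultimately have "K \<in> sets borel" by auto
    moreover have "K \<subseteq> B" using CT(3) by (auto simp: K_def)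
    moreover have "{z::complex. cmod z \<in> B - K} \<subseteq> T" using CT(3) by (auto simp: K_def)
    hence "{z::complex. cmod z \<in> B - K} \<in> null_sets lebesgue"
      using CT(2) null_sets_completion_subset by blast
    ultimately show ?thesis by blast
  qed
  define A' where "A' = {0..<1} - A"
  have "{z::complex. cmod z \<in> A'} = ball 0 1 - {z. cmod z \<in> A}" by (auto simp: A'_def)
  hence S': "{z::complex. cmod z \<in> A'} \<in> sets lebesgue" using S by auto
  obtain K where K: "K \<in> sets borel" "K \<subseteq> A" "{z::complex. cmod z \<in> A - K} \<in> null_sets lebesgue"
    using inner[OF S] by blast
  obtain K' where K': "K' \<in> sets borel" "K' \<subseteq> A'" "{z::complex. cmod z \<in> A' - K'} \<in> null_sets lebesgue"
    using inner[OF S'] by blast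
  \<comment> \<open>The radii reached by neither Borel kernel. R is Borel and its lift to the disc
    is null, so R is null; it contains A - K because K' does not meet A. Thus A differs from the
    Borel set K by a null set.\<close>
  define R where "R = {0..<1} - (K \<union> K')"
  have R: "R \<in> sets borel" "R \<subseteq> {0..<1}" using K K' by (auto simp: R_def)
  have "{z::complex. cmod z \<in> R} \<subseteq> {z. cmod z \<in> A - K} \<union> {z. cmod z \<in> A' - K'}"
    by (auto simp: R_def A'_def)
  moreover have "{z::complex. cmod z \<in> A - K} \<union> {z. cmod z \<in> A' - K'} \<in> null_sets lebesgue"
    using K(3) K'(3) by (rule null_sets.Un)
  ultimately have "{z::complex. cmod z \<in> R} \<in> null_sets lebesgue"
    using null_sets_completion_subset by blast
  moreover have "{z::complex. cmod z \<in> R} \<in> sets borel" using R by measurable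
  ultimately have "{z::complex. cmod z \<in> R} \<in> null_sets lborel"
    by (simp add: null_sets_completion_iff)
  hence "R \<in> null_sets lborel" using null_sets_radial_iff[OF R] by blast
  hence "R \<in> null_sets lebesgue" by (simp add: null_sets_completionI)
  moreover have "A - K \<subseteq> R" using A K' by (auto simp: R_def A'_def)
  ultimately have "A - K \<in> null_sets lebesgue" using null_sets_completion_subset by blast
  moreover have "A = K \<union> (A - K)" using K by auto
  ultimately show ?thesis using K(1) by (metis null_setsD2 sets.Un sets_completionI_sets sets_lborel)
qed

text \<open>Measurability in the plane says nothing in general about the restriction to one radius.
  For a radial function, however, a preimage along the radius lifts to a measurable planar set, and
  \<open>lebesgue_radial_sets\<close> brings measurability back. The Borel representative then
  agrees with \<omega> off a null set of radii, which lifts to a null set of the disc.\<close>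

lemma radial_borel_version:
  fixes \<omega> :: "complex \<Rightarrow> real"
  assumes meas: "\<omega> \<in> borel_measurable (lebesgue_on (ball 0 1))"
    and rad: "\<And>z. z \<in> ball 0 1 \<Longrightarrow> \<omega> z = \<omega> (of_real (cmod z))"
  obtains w :: "real \<Rightarrow> real" where "w \<in> borel_measurable borel"
    "AE s in lborel. 0 \<le> s \<and> s < 1 \<longrightarrow> \<omega> (of_real s) = w s"
    "AE z in lborel. z \<in> ball 0 1 \<longrightarrow> \<omega> z = w (cmod z)"
proof -
  define g where "g s = (if s \<in> {0..<1} then \<omega> (of_real s) else 0)" for s
  have "(\<lambda>z. if z \<in> ball 0 1 then \<omega> z else 0) \<in> borel_measurable lebesgue"
    using meas by (subst borel_measurable_if) auto
  also have "(\<lambda>z. if z \<in> ball 0 1 then \<omega> z else 0) = (\<lambda>z. g (cmod z))"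
  proof
    show "(if z \<in> ball 0 1 then \<omega> z else 0) = g (cmod z)" for z
      using rad[of z] by (auto simp: g_def)
  qed
  finally have gm: "(\<lambda>z. g (cmod z)) \<in> borel_measurable lebesgue" .
  have "(\<lambda>s. if s \<in> {0..<1} then g s else 0) \<in> borel_measurable lebesgue"
  proof (subst borel_measurable_if, simp, rule borel_measurableI)
    fix B :: "real set" assume "open B"
    let ?A = "g -` B \<inter> {0..<1}"
    have "{z. cmod z \<in> ?A} = ((\<lambda>z. g (cmod z)) -` B \<inter> space lebesgue) \<inter> ball 0 1" by auto
    also have "\<dots> \<in> sets lebesgue"
      using measurable_sets[OF gm, of B] \<open>open B\<close> by (intro sets.Int) auto
    finally have "?A \<in> sets lebesgue" by (intro lebesgue_radial_sets) auto
    thus "g -` B \<inter> space (lebesgue_on {0..<1}) \<in> sets (lebesgue_on {0..<1})"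
      by (auto simp: space_restrict_space sets_restrict_space_iff)
  qed
  also have "(\<lambda>s. if s \<in> {0..<1} then g s else 0) = g" by (auto simp: g_def)
  finally obtain w where w: "w \<in> borel_measurable lborel" "AE s in lborel. g s = w s"
    using completion_ex_borel_measurable_real by blast
  from w(2) obtain N where N: "N \<in> null_sets lborel" "\<And>s. g s \<noteq> w s \<Longrightarrow> s \<in> N"
    unfolding eventually_ae_filter by auto
  have [measurable]: "N \<in> sets borel" using N(1) by auto
  have "N \<inter> {0..<1} \<in> null_sets lborel" using N(1) by (rule null_set_Int2) simp
  hence "{z::complex. cmod z \<in> N \<inter> {0..<1}} \<in> null_sets lborel"
    by (subst null_sets_radial_iff[symmetric]) auto
  hence "AE z in lborel. z \<notin> {z::complex. cmod z \<in> N \<inter> {0..<1}}" by (rule AE_not_in)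
  hence "AE z in lborel. z \<in> ball 0 1 \<longrightarrow> \<omega> z = w (cmod z)"
  proof eventually_elim
    case (elim z)
    show ?case
    proof
      assume z: "z \<in> ball 0 1"
      hence "g (cmod z) = w (cmod z)" using elim N(2) by auto
      thus "\<omega> z = w (cmod z)" using z rad[OF z] by (auto simp: g_def)
    qed
  qed
  moreover have "AE s in lborel. 0 \<le> s \<and> s < 1 \<longrightarrow> \<omega> (of_real s) = w s"
    using w(2) by eventually_elim (auto simp: g_def)
  ultimately show ?thesis using that w(1) by auto
qed

subsection \<open>Local averages\<close>

lemma doubling_iterate:
  fixes h :: "real \<Rightarrow> ennreal" and C :: ennreal
  assumes "\<And>x. 0 \<le> x \<Longrightarrow> x < 1 \<Longrightarrow> h x \<le> C * h ((1 + x) / 2)" and "0 \<le> x" "x < 1"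
  shows "h x \<le> C ^ n * h (1 - (1 - x) / 2 ^ n)"
proof (induction n)
  case (Suc n)
  define q where "q = (1 - x) / 2 ^ n"
  have "q \<le> (1 - x) / 1" unfolding q_def using assms by (intro divide_left_mono) auto
  moreover have "0 < q" unfolding q_def using assms(3) by simp
  ultimately have "0 \<le> 1 - q" "1 - q < 1" using assms(2) by simp_all
  hence "0 \<le> 1 - (1 - x) / 2 ^ n" "1 - (1 - x) / 2 ^ n < 1" unfolding q_def .
  from assms(1)[OF this] have "h (1 - (1 - x) / 2 ^ n) \<le> C * h (1 - (1 - x) / 2 ^ Suc n)"
    by (simp add: field_simps)
  hence "C ^ n * h (1 - (1 - x) / 2 ^ n) \<le> C ^ n * (C * h (1 - (1 - x) / 2 ^ Suc n))"
    by (intro mult_left_mono) auto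
  with Suc.IH show ?case by (simp add: mult_ac)
qed simp

text \<open>Widening an annulus at the boundary by the factor \<kappa> costs finitely many
  doublings, their number depending on \<kappa> but not on t. The rest is the passage between
  integrals in ds and planar integrals, whose density is 2 pi s.\<close>

lemma radial_tail_doubling:
  fixes W :: "real \<Rightarrow> ennreal" and C \<kappa> :: real
  defines "h \<equiv> \<lambda>x. \<integral>\<^sup>+s\<in>{x..<1}. W s \<partial>lborel"
  assumes [measurable]: "W \<in> borel_measurable borel" and "C \<ge> 0"
    and dbl: "\<And>x. 0 \<le> x \<Longrightarrow> x < 1 \<Longrightarrow> h x \<le> ennreal C * h ((1 + x) / 2)"
  obtains K where "K \<ge> 0" "\<And>t. 0 \<le> t \<Longrightarrow> t < 1 \<Longrightarrow>
    (\<integral>\<^sup>+z\<in>{z. 1 - \<kappa> * (1 - t) \<le> cmod z \<and> cmod z < 1}. W (cmod z) \<partial>lborel)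
      \<le> ennreal K * (\<integral>\<^sup>+z\<in>{z. t < cmod z \<and> cmod z < 1}. W (cmod z) \<partial>lborel)"
proof -
  \<comment> \<open>Each doubling halves the distance to 1. As 2^n exceeds \<kappa>, n halvings
    starting from x pass t; as it exceeds 2, they pass 1/2 as well.\<close>
  obtain n where n: "max \<kappa> 2 < 2 ^ n" using real_arch_pow[of 2 "max \<kappa> 2"] by auto
  show ?thesis
  proof
    \<comment> \<open>C^n comes from the n doublings, and 2 is the ratio of the upper bound 2 pi and
      the lower bound pi for the density.\<close>
    show "2 * C ^ n \<ge> 0" using \<open>C \<ge> 0\<close> by simp
    fix t :: real assume t: "0 \<le> t" "t < 1"
    define x where "x = max 0 (1 - \<kappa> * (1 - t))"
    \<comment> \<open>The density 2 pi s degenerates at the origin; from 1/2 on it is at least pi.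
      The part of the annulus inside |z| < 1/2 is simply given away.\<close>
    define t' where "t' = max t (1 / 2)"
    have hanti: "h b \<le> h a" if "a \<le> b" for a b
      unfolding h_def by (intro nn_integral_mono) (use that in \<open>auto simp: indicator_def\<close>)
    have main: "h x \<le> ennreal (C ^ n) * h t'"
    proof (cases "x < 1")
      case True
      have "1 - x \<le> \<kappa> * (1 - t)" by (simp add: x_def)
      also have "\<dots> \<le> 2 ^ n * (1 - t)" using n t by (intro mult_right_mono) auto
      finally have "(1 - x) / 2 ^ n \<le> 1 - t" by (simp add: field_simps)
      moreover have "(1 - x) / 2 ^ n \<le> 1 / 2"
      proof -
        have "(1 - x) / 2 ^ n \<le> 1 / 2 ^ n" by (intro divide_right_mono) (auto simp: x_def)
        also have "\<dots> \<le> 1 / 2" using n by (intro divide_left_mono) auto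
        finally show ?thesis .
      qed
      ultimately have "t' \<le> 1 - (1 - x) / 2 ^ n" by (auto simp: t'_def)
      hence "h (1 - (1 - x) / 2 ^ n) \<le> h t'" by (rule hanti)
      moreover have "h x \<le> ennreal C ^ n * h (1 - (1 - x) / 2 ^ n)"
        by (rule doubling_iterate[where h = h and C = "ennreal C", OF dbl]) (use True in \<open>auto simp: x_def\<close>)
      ultimately show ?thesis
        using \<open>C \<ge> 0\<close> by (simp add: ennreal_power order_trans[OF _ mult_left_mono])
    next
      case False
      hence "{x..<1} = {}" by auto
      thus ?thesis by (simp add: h_def)
    qed
    have "(\<integral>\<^sup>+z\<in>{z. 1 - \<kappa> * (1 - t) \<le> cmod z \<and> cmod z < 1}. W (cmod z) \<partial>lborel)
        = (\<integral>\<^sup>+z\<in>ball (0::complex) 1. W (cmod z) * indicator {x..} (cmod z) \<partial>lborel)"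
      by (intro nn_integral_cong) (auto simp: indicator_def x_def)
    also have "\<dots> = (\<integral>\<^sup>+s\<in>{0..<1}. W s * indicator {x..} s * ennreal (2 * pi * s) \<partial>lborel)"
      by (rule nn_integral_radial_disc[where F = "\<lambda>s. W s * indicator {x..} s"]) measurable
    also have "\<dots> \<le> (\<integral>\<^sup>+s. ennreal (2 * pi) * (W s * indicator {x..<1} s) \<partial>lborel)"
    proof (rule nn_integral_mono)
      fix s :: real
      have "W s * ennreal (2 * pi * s) \<le> ennreal (2 * pi) * W s" if "0 \<le> s" "s < 1"
      proof -
        have "ennreal (2 * pi * s) \<le> ennreal (2 * pi)" using that by (intro ennreal_leI) simp
        thus ?thesis by (simp add: mult.commute mult_left_mono)
      qed
      thus "W s * indicator {x..} s * ennreal (2 * pi * s) * indicator {0..<1} s \<le> ennreal (2 * pi) * (W s * indicator {x..<1} s)"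
        by (auto simp: indicator_def)
    qed
    also have "\<dots> = ennreal (2 * pi) * h x"
      unfolding h_def by (rule nn_integral_cmult) measurable
    also have "\<dots> \<le> ennreal (2 * pi) * (ennreal (C ^ n) * h t')"
      by (intro mult_left_mono main) simp
    also have "\<dots> = ennreal (2 * C ^ n) * (ennreal pi * h t')"
      using \<open>C \<ge> 0\<close> by (simp add: ennreal_mult mult_ac)
    also have "ennreal pi * h t' = (\<integral>\<^sup>+s. ennreal pi * (W s * indicator {t'..<1} s) \<partial>lborel)"
      unfolding h_def by (rule nn_integral_cmult[symmetric]) measurable
    also have "\<dots> \<le> (\<integral>\<^sup>+s\<in>{0..<1}. W s * indicator {t<..} s * ennreal (2 * pi * s) \<partial>lborel)"
    proof (rule nn_integral_mono_AE, use AE_lborel_singleton[of t] in eventually_elim)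
      fix s :: real assume "s \<noteq> t"
      have "ennreal pi * W s \<le> W s * ennreal (2 * pi * s)" if "1 / 2 \<le> s"
      proof -
        have "ennreal pi \<le> ennreal (2 * pi * s)" using that by (intro ennreal_leI) simp
        thus ?thesis unfolding mult.commute[of "ennreal pi"] by (intro mult_left_mono) simp_all
      qed
      thus "ennreal pi * (W s * indicator {t'..<1} s) \<le> W s * indicator {t<..} s * ennreal (2 * pi * s) * indicator {0..<1} s"
        using \<open>s \<noteq> t\<close> t by (auto simp: indicator_def t'_def)
    qed
    also have "\<dots> = (\<integral>\<^sup>+z\<in>ball (0::complex) 1. W (cmod z) * indicator {t<..} (cmod z) \<partial>lborel)"
      by (rule nn_integral_radial_disc[where F = "\<lambda>s. W s * indicator {t<..} s", symmetric]) measurable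
    also have "\<dots> = (\<integral>\<^sup>+z\<in>{z. t < cmod z \<and> cmod z < 1}. W (cmod z) \<partial>lborel)"
      by (intro nn_integral_cong) (auto simp: indicator_def)
    finally show "(\<integral>\<^sup>+z\<in>{z. 1 - \<kappa> * (1 - t) \<le> cmod z \<and> cmod z < 1}. W (cmod z) \<partial>lborel)
      \<le> ennreal (2 * C ^ n) * (\<integral>\<^sup>+z\<in>{z. t < cmod z \<and> cmod z < 1}. W (cmod z) \<partial>lborel)"
      by (simp add: mult_left_mono)
  qed
qed

section \<open>Pseudohyperbolic discs and their Euclidean neighbourhoods\<close>

lemma pseudohyperbolic_disc_bound:
  assumes z: "z \<in> \<bbbD>" and r: "0 \<le> r" "r < 1" and \<zeta>: "\<zeta> \<in> pseudohyperbolic_disc z r"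
  shows "cmod (\<zeta> - z) \<le> 2 * r / (1 - r) * (1 - cmod z)" (is ?th1)
    and "1 - cmod z \<le> (1 + 2 * r / (1 - r)) * (1 - cmod \<zeta>)" (is ?th2)
proof -
  have \<zeta>1: "cmod \<zeta> < 1" and z1: "cmod z < 1" and lt: "cmod (disc_automorphism z \<zeta>) < r"
    using \<zeta> z by (auto simp: pseudohyperbolic_disc_def)
  have "cmod (cnj z * \<zeta>) < 1" using \<zeta>1 z1 by (simp add: norm_mult) (metis mult_strict_mono' norm_ge_zero mult_1)
  hence "1 - cnj z * \<zeta> \<noteq> 0" by auto
  hence dist: "cmod (\<zeta> - z) \<le> r * cmod (1 - cnj z * \<zeta>)"
    using lt by (simp add: disc_automorphism_def norm_divide field_simps norm_minus_commute)
  \<comment> \<open>The identity 1 - cnj a * b = (1 - |a|^2) - cnj a * (b - a) bounds the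
    denominator by 2(1 - |a|) + |b - a|; since r < 1, the second term can be absorbed on the left.
    The pair (a, b) is kept general because both quantities are symmetric: (z, \<zeta>) gives the
    first claim and (\<zeta>, z) leads to the second.\<close>
  have key: "cmod (\<zeta> - z) \<le> 2 * r / (1 - r) * (1 - cmod a)"
    if a: "cmod a < 1" and b: "cmod (b - a) = cmod (\<zeta> - z)" "cmod (1 - cnj a * b) = cmod (1 - cnj z * \<zeta>)" for a b
  proof -
    have "of_real (1 - (cmod a)\<^sup>2) = 1 - a * cnj a"
      by (simp only: of_real_diff of_real_1 complex_norm_square)
    hence "1 - cnj a * b = of_real (1 - (cmod a)\<^sup>2) - cnj a * (b - a)"
      by (simp add: algebra_simps)
    hence "cmod (1 - cnj a * b) \<le> cmod (of_real (1 - (cmod a)\<^sup>2)) + cmod (cnj a * (b - a))"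
      by (metis norm_triangle_ineq4)
    also have "cmod (of_real (1 - (cmod a)\<^sup>2)) = (1 - cmod a) * (1 + cmod a)"
    proof -
      have "(cmod a)\<^sup>2 \<le> 1" using a by (simp add: power_le_one)
      thus ?thesis by (simp only: norm_of_real) (simp add: power2_eq_square algebra_simps)
    qed
    also have "\<dots> \<le> (1 - cmod a) * 2" using a by (intro mult_left_mono) auto
    also have "cmod (cnj a * (b - a)) \<le> 1 * cmod (b - a)"
      unfolding norm_mult by (intro mult_right_mono) (use a in auto)
    finally have "cmod (1 - cnj z * \<zeta>) \<le> 2 * (1 - cmod a) + cmod (\<zeta> - z)" using b by simp
    hence "r * cmod (1 - cnj z * \<zeta>) \<le> r * (2 * (1 - cmod a) + cmod (\<zeta> - z))"
      using r by (intro mult_left_mono)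
    with dist have "cmod (\<zeta> - z) * (1 - r) \<le> 2 * r * (1 - cmod a)" by (simp add: algebra_simps)
    thus ?thesis using r by (simp add: pos_le_divide_eq)
  qed
  show ?th1 by (rule key[of z \<zeta>]) (use z1 in auto)
  have "cmod (1 - cnj \<zeta> * z) = cmod (1 - cnj z * \<zeta>)"
  proof -
    have "1 - cnj \<zeta> * z = cnj (1 - cnj z * \<zeta>)" by simp
    thus ?thesis by (metis complex_mod_cnj)
  qed
  hence "cmod (\<zeta> - z) \<le> 2 * r / (1 - r) * (1 - cmod \<zeta>)"
    by (intro key[of \<zeta> z]) (use \<zeta>1 in \<open>auto simp: norm_minus_commute\<close>)
  moreover have "1 - cmod z \<le> (1 - cmod \<zeta>) + cmod (\<zeta> - z)" using norm_triangle_ineq2[of \<zeta> z] by simp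
  ultimately show ?th2 by (simp add: distrib_right)
qed

text \<open>With \<open>\<kappa> = 1 + 2r/(1 - r)\<close>, this region contains the Euclidean disc of radius
  \<open>(1 - |z|)/(2\<kappa>)\<close> about every point of \<open>\<Delta>(z,r)\<close>.\<close>

definition disc_nbhd :: "real \<Rightarrow> complex \<Rightarrow> complex set" where
  "disc_nbhd \<kappa> z = {\<eta>. cmod \<eta> < 1 \<and> cmod (\<eta> - z) < \<kappa> * (1 - cmod z) \<and> 1 - cmod z \<le> 2 * \<kappa> * (1 - cmod \<eta>)}"

lemma measurable_disc_nbhd [measurable]: "Measurable.pred (borel \<Otimes>\<^sub>M borel) (\<lambda>x. snd x \<in> disc_nbhd \<kappa> (fst x))"
  unfolding disc_nbhd_def by measurable

lemma disc_nbhd_rotate: "cmod c = 1 \<Longrightarrow> c * \<eta> \<in> disc_nbhd \<kappa> (c * z) \<longleftrightarrow> \<eta> \<in> disc_nbhd \<kappa> z"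
  by (simp add: disc_nbhd_def norm_mult flip: right_diff_distrib)

text \<open>The sub-mean value property at \<zeta>, with a disc whose size and enclosing region
  depend on z alone. The right-hand side is therefore the same for all \<zeta> in the
  pseudohyperbolic disc and bounds the supremum there.\<close>

lemma powr_le_integral_disc_nbhd:
  assumes hol: "f holomorphic_on \<bbbD>" and "p > 0" and r: "0 \<le> r" "r < 1" and z: "z \<in> \<bbbD>"
    and \<zeta>: "\<zeta> \<in> pseudohyperbolic_disc z r"
  defines "\<kappa> \<equiv> 1 + 2 * r / (1 - r)"
  shows "ennreal (cmod (f \<zeta>) powr p)
    \<le> ennreal (4 * \<kappa>\<^sup>2 / pi) * ennreal (1 / (1 - cmod z)\<^sup>2) * (\<integral>\<^sup>+\<eta>\<in>disc_nbhd \<kappa> z. ennreal (cmod (f \<eta>) powr p) \<partial>lborel)"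
proof -
  \<comment> \<open>As 1 - |z| \<le> \<kappa> (1 - |\<zeta>|), this radius is at most half the
    distance from \<zeta> to the unit circle. The disc about \<zeta> then keeps more than s away
    from the circle, which is the last condition of \<open>disc_nbhd\<close>.\<close>
  define s where "s = (1 - cmod z) / (2 * \<kappa>)"
  have \<kappa>: "\<kappa> \<ge> 1" using r by (simp add: \<kappa>_def)
  have z1: "cmod z < 1" using z by simp
  have s: "s > 0" "s \<le> (1 - cmod z) / 2"
    using z1 \<kappa> unfolding s_def by (simp, intro divide_left_mono) auto
  have \<kappa>': "2 * r / (1 - r) = \<kappa> - 1" by (simp add: \<kappa>_def)
  note b = pseudohyperbolic_disc_bound[OF z r \<zeta>, unfolded \<kappa>']
  have b1: "cmod (\<zeta> - z) \<le> (\<kappa> - 1) * (1 - cmod z)" by (rule b(1))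
  have "2 * s = (1 - cmod z) / \<kappa>" using \<kappa> by (simp add: s_def field_simps)
  hence b2: "2 * s \<le> 1 - cmod \<zeta>" using b(2) \<kappa> by (simp add: pos_divide_le_eq mult.commute)
  have sub: "ball \<zeta> s \<subseteq> disc_nbhd \<kappa> z"
  proof
    fix \<eta> assume "\<eta> \<in> ball \<zeta> s"
    hence d: "cmod (\<eta> - \<zeta>) < s" by (simp add: dist_norm norm_minus_commute)
    have "cmod \<eta> \<le> cmod \<zeta> + cmod (\<eta> - \<zeta>)" by norm
    hence e: "s < 1 - cmod \<eta>" using d b2 by linarith
    have "cmod (\<eta> - z) \<le> cmod (\<eta> - \<zeta>) + cmod (\<zeta> - z)" by norm
    also have "\<dots> < (1 - cmod z) + (\<kappa> - 1) * (1 - cmod z)"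
    proof (rule add_less_le_mono[OF _ b1])
      show "cmod (\<eta> - \<zeta>) < 1 - cmod z" using d s(2) z1 by simp
    qed
    also have "\<dots> = \<kappa> * (1 - cmod z)" by (simp add: algebra_simps)
    finally have "cmod (\<eta> - z) < \<kappa> * (1 - cmod z)" .
    moreover have "1 - cmod z \<le> 2 * \<kappa> * (1 - cmod \<eta>)"
      using e \<kappa> by (simp add: s_def field_simps)
    ultimately show "\<eta> \<in> disc_nbhd \<kappa> z" using e s(1) by (simp add: disc_nbhd_def)
  qed
  have "ball \<zeta> s \<subseteq> \<bbbD>" using sub by (auto simp: disc_nbhd_def)
  hence "f holomorphic_on ball \<zeta> s" using hol holomorphic_on_subset by blast
  hence "ennreal (cmod (f \<zeta>) powr p) * ennreal (pi * s\<^sup>2) \<le> (\<integral>\<^sup>+\<eta>\<in>ball \<zeta> s. ennreal (cmod (f \<eta>) powr p) \<partial>lborel)"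
    using \<open>p > 0\<close> s(1) by (rule holomorphic_powr_submean)
  also have "\<dots> \<le> (\<integral>\<^sup>+\<eta>\<in>disc_nbhd \<kappa> z. ennreal (cmod (f \<eta>) powr p) \<partial>lborel)" (is "_ \<le> ?I")
    using sub by (intro nn_integral_mono) (auto simp: indicator_def)
  finally have "ennreal (1 / (pi * s\<^sup>2)) * (ennreal (cmod (f \<zeta>) powr p) * ennreal (pi * s\<^sup>2)) \<le> ennreal (1 / (pi * s\<^sup>2)) * ?I"
    by (rule mult_left_mono) simp
  also have "ennreal (1 / (pi * s\<^sup>2)) * (ennreal (cmod (f \<zeta>) powr p) * ennreal (pi * s\<^sup>2)) = ennreal (cmod (f \<zeta>) powr p)"
    using s(1) by (simp flip: ennreal_mult)
  also have "1 / (pi * s\<^sup>2) = 4 * \<kappa>\<^sup>2 / pi * (1 / (1 - cmod z)\<^sup>2)"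
    using z1 \<kappa> by (simp add: s_def field_simps power2_eq_square)
  also have "ennreal (4 * \<kappa>\<^sup>2 / pi * (1 / (1 - cmod z)\<^sup>2)) = ennreal (4 * \<kappa>\<^sup>2 / pi) * ennreal (1 / (1 - cmod z)\<^sup>2)"
    by (rule ennreal_mult) simp_all
  finally show ?thesis .
qed

lemma integral_disc_nbhd_weight_le:
  fixes W :: "real \<Rightarrow> ennreal" and \<kappa> K :: real
  assumes [measurable]: "W \<in> borel_measurable borel" and "\<kappa> \<ge> 1" "K \<ge> 0"
    and tail: "\<And>t. 0 \<le> t \<Longrightarrow> t < 1 \<Longrightarrow>
      (\<integral>\<^sup>+z\<in>{z. 1 - 2 * \<kappa> * (1 - t) \<le> cmod z \<and> cmod z < 1}. W (cmod z) \<partial>lborel)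
        \<le> ennreal K * (\<integral>\<^sup>+z\<in>{z. t < cmod z \<and> cmod z < 1}. W (cmod z) \<partial>lborel)"
    and hol: "f holomorphic_on \<bbbD>" and "p > 0"
  shows "(\<integral>\<^sup>+z\<in>\<bbbD>. W (cmod z) * (ennreal (1 / (1 - cmod z)\<^sup>2) *
            (\<integral>\<^sup>+\<eta>\<in>disc_nbhd \<kappa> z. ennreal (cmod (f \<eta>) powr p) \<partial>lborel)) \<partial>lborel)
    \<le> ennreal (pi * \<kappa>\<^sup>2 * K) * (\<integral>\<^sup>+z\<in>\<bbbD>. ennreal (cmod (f z) powr p) * W (cmod z) \<partial>lborel)"
proof -
  have [measurable]: "\<bbbD> \<in> sets borel" by simp
  define u where "u z = ennreal (cmod (f z) powr p) * indicator \<bbbD> z" for z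
  have "continuous_on \<bbbD> (\<lambda>z. cmod (f z) powr p)"
    using \<open>p > 0\<close> holomorphic_on_imp_continuous_on[OF hol] by (intro continuous_intros continuous_on_powr') auto
  hence [measurable]: "u \<in> borel_measurable borel"
    unfolding u_def[abs_def] by (rule borel_measurable_continuous_on_times_indicator) simp
  define k where "k z = W (cmod z) * ennreal (1 / (1 - cmod z)\<^sup>2) * indicator \<bbbD> z" for z :: complex
  have [measurable]: "k \<in> borel_measurable borel" unfolding k_def[abs_def] by measurable
  \<comment> \<open>The weight that |f(\<eta>)|^p receives once the integrals are exchanged.\<close>
  define V where "V \<eta> = (\<integral>\<^sup>+z. k z * indicator (disc_nbhd \<kappa> z) \<eta> \<partial>lborel)" for \<eta>
  have ind [measurable]: "(\<lambda>x. indicator (disc_nbhd \<kappa> (fst x)) (snd x) :: ennreal) \<in> borel_measurable (borel \<Otimes>\<^sub>M borel)"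
    by measurable
  have ind' [measurable]: "(\<lambda>x. indicator (disc_nbhd \<kappa> (snd x)) (fst x) :: ennreal) \<in> borel_measurable (borel \<Otimes>\<^sub>M borel)"
    using measurable_compose[OF measurable_pair_swap' ind] by (simp add: case_prod_unfold)
  have ind1 [measurable]: "(\<lambda>z. indicator (disc_nbhd \<kappa> z) \<eta> :: ennreal) \<in> borel_measurable borel" for \<eta>
    using measurable_compose[OF measurable_Pair2'[of \<eta> borel borel] ind] by simp
  have ind2 [measurable]: "(\<lambda>\<eta>. indicator (disc_nbhd \<kappa> z) \<eta> :: ennreal) \<in> borel_measurable borel" for z
    using measurable_compose[OF measurable_Pair1'[of z borel borel] ind] by simp
  have [measurable]: "V \<in> borel_measurable borel"
    unfolding V_def[abs_def] by (rule lborel.borel_measurable_nn_integral) (simp add: case_prod_unfold)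
  have V_rot: "V (c * \<eta>) = V \<eta>" if c: "cmod c = 1" for c \<eta>
  proof -
    have "V (c * \<eta>) = (\<integral>\<^sup>+z. k (c * z) * indicator (disc_nbhd \<kappa> (c * z)) (c * \<eta>) \<partial>lborel)"
      unfolding V_def
      by (rule nn_integral_lborel_rotate[OF c, where f = "\<lambda>z. k z * indicator (disc_nbhd \<kappa> z) (c * \<eta>)", symmetric]) measurable
    also have "\<dots> = V \<eta>" unfolding V_def
      by (intro nn_integral_cong) (simp add: k_def norm_mult c disc_nbhd_rotate[OF c] indicator_def)
    finally show ?thesis .
  qed
  have V_tail: "(\<integral>\<^sup>+\<eta>\<in>{\<eta>. t \<le> cmod \<eta> \<and> cmod \<eta> < 1}. V \<eta> \<partial>lborel)
      \<le> ennreal (pi * \<kappa>\<^sup>2 * K) * (\<integral>\<^sup>+z\<in>{z. t < cmod z \<and> cmod z < 1}. W (cmod z) \<partial>lborel)"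
    if t: "0 \<le> t" "t < 1" for t
  proof -
    let ?A = "{\<eta>::complex. t \<le> cmod \<eta> \<and> cmod \<eta> < 1}"
    have [measurable]: "?A \<in> sets borel" by measurable
    have "(\<integral>\<^sup>+\<eta>\<in>?A. V \<eta> \<partial>lborel) = (\<integral>\<^sup>+\<eta>. (\<integral>\<^sup>+z. k z * indicator (disc_nbhd \<kappa> z) \<eta> * indicator ?A \<eta> \<partial>lborel) \<partial>lborel)"
      unfolding V_def by (intro nn_integral_cong nn_integral_multc[symmetric]) measurable
    also have "\<dots> = (\<integral>\<^sup>+z. (\<integral>\<^sup>+\<eta>. k z * indicator (disc_nbhd \<kappa> z) \<eta> * indicator ?A \<eta> \<partial>lborel) \<partial>lborel)"
      by (rule lborel_pair.Fubini') (simp add: case_prod_unfold)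
    also have "\<dots> \<le> (\<integral>\<^sup>+z. ennreal (pi * \<kappa>\<^sup>2) * (W (cmod z) * indicator {z. 1 - 2 * \<kappa> * (1 - t) \<le> cmod z \<and> cmod z < 1} z) \<partial>lborel)"
    proof (rule nn_integral_mono)
      \<comment> \<open>If \<eta> lies in the annulus and in the neighbourhood of z, the last
        condition of \<open>disc_nbhd\<close> gives 1 - |z| \<le> 2\<kappa>(1 - t), so other z
        contribute nothing. For the remaining z the neighbourhood has area at most pi \<kappa>^2 (1
        - |z|)^2, and the kernel cancels the power of 1 - |z|.\<close>
      fix z :: complex
      show "(\<integral>\<^sup>+\<eta>. k z * indicator (disc_nbhd \<kappa> z) \<eta> * indicator ?A \<eta> \<partial>lborel)
          \<le> ennreal (pi * \<kappa>\<^sup>2) * (W (cmod z) * indicator {z. 1 - 2 * \<kappa> * (1 - t) \<le> cmod z \<and> cmod z < 1} z)"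
      proof (cases "cmod z < 1 \<and> 1 - 2 * \<kappa> * (1 - t) \<le> cmod z")
        case False
        have "k z * indicator (disc_nbhd \<kappa> z) \<eta> * indicator ?A \<eta> = 0" for \<eta>
        proof (cases "\<eta> \<in> disc_nbhd \<kappa> z \<and> \<eta> \<in> ?A \<and> cmod z < 1")
          case True
          hence "1 - cmod z \<le> 2 * \<kappa> * (1 - cmod \<eta>)" "t \<le> cmod \<eta>" by (auto simp: disc_nbhd_def)
          moreover have "2 * \<kappa> * (1 - cmod \<eta>) \<le> 2 * \<kappa> * (1 - t)"
            using \<open>\<kappa> \<ge> 1\<close> \<open>t \<le> cmod \<eta>\<close> by (intro mult_left_mono) auto
          ultimately show ?thesis using False True by linarith
        qed (auto simp: indicator_def k_def)
        hence "(\<integral>\<^sup>+\<eta>. k z * indicator (disc_nbhd \<kappa> z) \<eta> * indicator ?A \<eta> \<partial>lborel) = (\<integral>\<^sup>+\<eta>. 0 \<partial>(lborel :: complex measure))"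
          by (intro nn_integral_cong) blast
        thus ?thesis by simp
      next
        case True
        define d where "d = 1 - cmod z"
        have d: "d > 0" using True by (simp add: d_def)
        have "(\<integral>\<^sup>+\<eta>. k z * indicator (disc_nbhd \<kappa> z) \<eta> * indicator ?A \<eta> \<partial>lborel)
            \<le> (\<integral>\<^sup>+\<eta>. k z * indicator (ball z (\<kappa> * d)) \<eta> \<partial>lborel)"
          by (intro nn_integral_mono) (auto simp: indicator_def disc_nbhd_def dist_norm norm_minus_commute d_def)
        also have "\<dots> = k z * ennreal (pi * (\<kappa> * d)\<^sup>2)"
          by (subst nn_integral_cmult_indicator) (use d \<open>\<kappa> \<ge> 1\<close> in \<open>simp_all add: emeasure_ball unit_ball_vol_2\<close>)
        also have "\<dots> = W (cmod z) * (ennreal (1 / d\<^sup>2) * ennreal (pi * (\<kappa> * d)\<^sup>2))"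
          using True by (simp add: k_def d_def mult_ac)
        also have "ennreal (1 / d\<^sup>2) * ennreal (pi * (\<kappa> * d)\<^sup>2) = ennreal (pi * \<kappa>\<^sup>2)"
          using d by (subst ennreal_mult[symmetric]) (auto simp: power_mult_distrib)
        finally show ?thesis using True by (simp add: mult.commute)
      qed
    qed
    also have "\<dots> = ennreal (pi * \<kappa>\<^sup>2) * (\<integral>\<^sup>+z\<in>{z. 1 - 2 * \<kappa> * (1 - t) \<le> cmod z \<and> cmod z < 1}. W (cmod z) \<partial>lborel)"
      by (rule nn_integral_cmult) measurable
    also have "\<dots> \<le> ennreal (pi * \<kappa>\<^sup>2) * (ennreal K * (\<integral>\<^sup>+z\<in>{z. t < cmod z \<and> cmod z < 1}. W (cmod z) \<partial>lborel))"
      by (intro mult_left_mono tail t) simp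
    also have "\<dots> = ennreal (pi * \<kappa>\<^sup>2 * K) * (\<integral>\<^sup>+z\<in>{z. t < cmod z \<and> cmod z < 1}. W (cmod z) \<partial>lborel)"
      using \<open>K \<ge> 0\<close> by (simp add: ennreal_mult mult.assoc)
    finally show ?thesis .
  qed
  have "(\<integral>\<^sup>+z\<in>\<bbbD>. W (cmod z) * (ennreal (1 / (1 - cmod z)\<^sup>2) *
            (\<integral>\<^sup>+\<eta>\<in>disc_nbhd \<kappa> z. ennreal (cmod (f \<eta>) powr p) \<partial>lborel)) \<partial>lborel)
      = (\<integral>\<^sup>+z. (\<integral>\<^sup>+\<eta>. k z * (u \<eta> * indicator (disc_nbhd \<kappa> z) \<eta>) \<partial>lborel) \<partial>lborel)"
  proof (rule nn_integral_cong)
    fix z :: complex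
    have "(\<integral>\<^sup>+\<eta>. k z * (u \<eta> * indicator (disc_nbhd \<kappa> z) \<eta>) \<partial>lborel) = k z * (\<integral>\<^sup>+\<eta>. u \<eta> * indicator (disc_nbhd \<kappa> z) \<eta> \<partial>lborel)"
      by (rule nn_integral_cmult) measurable
    also have "(\<integral>\<^sup>+\<eta>. u \<eta> * indicator (disc_nbhd \<kappa> z) \<eta> \<partial>lborel) = (\<integral>\<^sup>+\<eta>\<in>disc_nbhd \<kappa> z. ennreal (cmod (f \<eta>) powr p) \<partial>lborel)"
      by (intro nn_integral_cong) (auto simp: u_def indicator_def disc_nbhd_def)
    finally show "W (cmod z) * (ennreal (1 / (1 - cmod z)\<^sup>2) * (\<integral>\<^sup>+\<eta>\<in>disc_nbhd \<kappa> z. ennreal (cmod (f \<eta>) powr p) \<partial>lborel)) * indicator \<bbbD> z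
        = (\<integral>\<^sup>+\<eta>. k z * (u \<eta> * indicator (disc_nbhd \<kappa> z) \<eta>) \<partial>lborel)"
      by (simp add: k_def mult_ac)
  qed
  also have "\<dots> = (\<integral>\<^sup>+\<eta>. (\<integral>\<^sup>+z. k z * (u \<eta> * indicator (disc_nbhd \<kappa> z) \<eta>) \<partial>lborel) \<partial>lborel)"
    by (rule lborel_pair.Fubini'[symmetric]) (simp add: case_prod_unfold)
  also have "\<dots> = (\<integral>\<^sup>+\<eta>. u \<eta> * V \<eta> \<partial>lborel)"
    unfolding V_def by (intro nn_integral_cong, subst nn_integral_cmult[symmetric]) (auto simp: mult_ac)
  also have "\<dots> = (\<integral>\<^sup>+\<eta>. u \<eta> * (V \<eta> * indicator \<bbbD> \<eta>) \<partial>lborel)"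
    by (intro nn_integral_cong) (auto simp: u_def indicator_def)
  \<comment> \<open>V is rotation invariant, so u may be replaced by its radially increasing means;
    after the comparison of tails the means are undone against W, which is radial too.\<close>
  also have "\<dots> = (\<integral>\<^sup>+\<eta>. rotation_mean u \<eta> * (V \<eta> * indicator \<bbbD> \<eta>) \<partial>lborel)"
    by (rule nn_integral_mult_radial[symmetric]) (auto simp: V_rot indicator_def norm_mult)
  also have "\<dots> \<le> ennreal (pi * \<kappa>\<^sup>2 * K) * (\<integral>\<^sup>+z\<in>\<bbbD>. rotation_mean u z * W (cmod z) \<partial>lborel)"
    unfolding mult.assoc[symmetric]
  proof (rule nn_integral_radially_increasing_le)
    show "rotation_mean u a \<le> rotation_mean u b" if "cmod a \<le> cmod b" "cmod b < 1" for a b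
      unfolding u_def[abs_def] by (rule rotation_mean_powr_mono[OF hol \<open>p > 0\<close> that])
  qed (use V_tail in \<open>simp_all add: mult.assoc\<close>)
  also have "(\<integral>\<^sup>+z\<in>\<bbbD>. rotation_mean u z * W (cmod z) \<partial>lborel) = (\<integral>\<^sup>+z. rotation_mean u z * (W (cmod z) * indicator \<bbbD> z) \<partial>lborel)"
    by (simp add: mult.assoc)
  also have "\<dots> = (\<integral>\<^sup>+z. u z * (W (cmod z) * indicator \<bbbD> z) \<partial>lborel)"
    by (rule nn_integral_mult_radial) (auto simp: indicator_def norm_mult)
  also have "\<dots> = (\<integral>\<^sup>+z\<in>\<bbbD>. ennreal (cmod (f z) powr p) * W (cmod z) \<partial>lborel)"
    by (intro nn_integral_cong) (auto simp: u_def indicator_def)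
  finally show ?thesis .
qed

text \<open>An average is at most a supremum. The default values agree with this: the average is 0
  when \<open>measure\<close> returns 0, and the integral is 0 when |f|^p is not integrable on the
  set.\<close>

lemma local_average_le:
  assumes "\<And>\<zeta>. \<zeta> \<in> E z \<Longrightarrow> ennreal (cmod (f \<zeta>) powr p) \<le> B" and "E z \<in> sets \<nu>"
  shows "ennreal (local_average p \<nu> E f z) \<le> B"
proof (cases B)
  case (real b)
  show ?thesis
  proof (cases "measure \<nu> (E z) = 0")
    case False
    hence pos: "measure \<nu> (E z) > 0" by (simp add: less_le)
    \<comment> \<open>\<open>measure\<close> is 0 on sets of infinite measure, so a nonzero value
      certifies finiteness.\<close>
    have fin: "emeasure \<nu> (E z) < \<infinity>" using False unfolding measure_def
      by (metis enn2real_top infinity_ennreal_def top.not_eq_extremum)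
    have "(LINT \<zeta>:E z|\<nu>. cmod (f \<zeta>) powr p) \<le> (LINT \<zeta>:E z|\<nu>. b)"
    proof (cases "set_integrable \<nu> (E z) (\<lambda>\<zeta>. cmod (f \<zeta>) powr p)")
      case True
      show ?thesis
      proof (rule set_integral_mono[OF True])
        show "set_integrable \<nu> (E z) (\<lambda>\<zeta>. b)"
          unfolding set_integrable_def using fin assms(2) by simp
        show "cmod (f \<zeta>) powr p \<le> b" if "\<zeta> \<in> E z" for \<zeta>
          using assms(1)[OF that] real by simp
      qed
    next
      case False
      hence "(LINT \<zeta>:E z|\<nu>. cmod (f \<zeta>) powr p) = 0"
        by (simp add: set_lebesgue_integral_def set_integrable_def not_integrable_integral_eq)
      also have "0 \<le> (LINT \<zeta>:E z|\<nu>. b)"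
        unfolding set_lebesgue_integral_def by (rule integral_nonneg_AE) (use real in auto)
      finally show ?thesis .
    qed
    also have "(LINT \<zeta>:E z|\<nu>. b) = measure \<nu> (E z) * b"
      unfolding set_lebesgue_integral_def using assms(2) sets.sets_into_space[OF assms(2)] by (simp add: Int_absorb2)
    finally have "local_average p \<nu> E f z \<le> b"
      using pos by (simp add: local_average_def field_simps)
    thus ?thesis using real by (simp add: ennreal_leI)
  qed (simp add: local_average_def)
qed simp


section \<open>The weighted estimate on the disc and the dominating set\<close>

lemma nn_integral_disc_area:
  assumes "g \<in> borel_measurable disc_area"
  shows "(\<integral>\<^sup>+z. g z \<partial>disc_area) = ennreal (1 / pi) * (\<integral>\<^sup>+z\<in>\<bbbD>. g z \<partial>lborel)"
proof -
  have "g \<in> borel_measurable (lebesgue_on \<bbbD>)"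
    using assms by (simp add: disc_area_def cong: measurable_cong_sets)
  thus ?thesis
    by (simp add: disc_area_def nn_integral_scale_measure nn_integral_restrict_space nn_integral_completion)
qed

text \<open>The doubling condition speaks of integrals along a radius, the estimates of integrals
  over annuli. The Borel representative w agrees with \<omega> almost everywhere in both senses and
  so links the two.\<close>

lemma D_hat_radial_tail:
  assumes "\<omega> \<in> D_hat"
  obtains w :: "real \<Rightarrow> real" and K :: real where "w \<in> borel_measurable borel"
    "AE z in lborel. z \<in> \<bbbD> \<longrightarrow> \<omega> z = w (cmod z)" "K \<ge> 0"
    "\<And>t. 0 \<le> t \<Longrightarrow> t < 1 \<Longrightarrow>
      (\<integral>\<^sup>+z\<in>{z. 1 - \<kappa> * (1 - t) \<le> cmod z \<and> cmod z < 1}. ennreal (w (cmod z)) \<partial>lborel)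
        \<le> ennreal K * (\<integral>\<^sup>+z\<in>{z. t < cmod z \<and> cmod z < 1}. ennreal (w (cmod z)) \<partial>lborel)"
proof -
  obtain C where C: "C \<ge> 1" "\<And>x. 0 \<le> x \<Longrightarrow> x < 1 \<Longrightarrow>
      weight_hat \<omega> (of_real x) \<le> ennreal C * weight_hat \<omega> (of_real ((1 + x) / 2))"
    and rad: "radial_weight \<omega>"
    using assms unfolding D_hat_def by blast
  have "\<omega> \<in> borel_measurable disc_area"
    using rad by (auto simp: radial_weight_def weight_def dest: borel_measurable_integrable)
  hence meas: "\<omega> \<in> borel_measurable (lebesgue_on \<bbbD>)" by (simp add: disc_area_def cong: measurable_cong_sets)
  have rot: "\<And>z. z \<in> \<bbbD> \<Longrightarrow> \<omega> z = \<omega> (of_real (cmod z))"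
    using rad unfolding radial_weight_def by blast
  obtain w where w: "w \<in> borel_measurable borel"
    "AE s in lborel. 0 \<le> s \<and> s < 1 \<longrightarrow> \<omega> (of_real s) = w s"
    "AE z in lborel. z \<in> \<bbbD> \<longrightarrow> \<omega> z = w (cmod z)"
    using radial_borel_version[OF meas rot] by blast
  have hat: "weight_hat \<omega> (of_real x) = (\<integral>\<^sup>+s\<in>{x..<1}. ennreal (w s) \<partial>lborel)" if "0 \<le> x" for x
  proof -
    have "weight_hat \<omega> (of_real x) = (\<integral>\<^sup>+s\<in>{x..<1}. ennreal (\<omega> (of_real s)) \<partial>lborel)"
      using that by (simp add: weight_hat_def nn_integral_completion)
    also have "\<dots> = (\<integral>\<^sup>+s\<in>{x..<1}. ennreal (w s) \<partial>lborel)"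
      by (rule nn_integral_cong_AE, use w(2) in eventually_elim) (use that in \<open>auto simp: indicator_def\<close>)
    finally show ?thesis .
  qed
  have "(\<integral>\<^sup>+s\<in>{x..<1}. ennreal (w s) \<partial>lborel) \<le> ennreal C * (\<integral>\<^sup>+s\<in>{(1 + x) / 2..<1}. ennreal (w s) \<partial>lborel)"
    if "0 \<le> x" "x < 1" for x
  proof -
    have "0 \<le> (1 + x) / 2" using that by simp
    from hat[OF this] show ?thesis using C(2)[OF that] hat[OF that(1)] by simp
  qed
  from radial_tail_doubling[of "\<lambda>s. ennreal (w s)" C \<kappa>, OF _ _ this] w(1) C(1)
  obtain K where "K \<ge> 0" "\<And>t. 0 \<le> t \<Longrightarrow> t < 1 \<Longrightarrow>
      (\<integral>\<^sup>+z\<in>{z. 1 - \<kappa> * (1 - t) \<le> cmod z \<and> cmod z < 1}. ennreal (w (cmod z)) \<partial>lborel)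
        \<le> ennreal K * (\<integral>\<^sup>+z\<in>{z. t < cmod z \<and> cmod z < 1}. ennreal (w (cmod z)) \<partial>lborel)"
    by (simp, blast)
  thus ?thesis using that w by blast
qed

lemma bergman_norm_powr:
  assumes "p > 0" and "\<And>z. z \<in> \<bbbD> \<Longrightarrow> 0 \<le> \<omega> z"
  shows "bergman_norm p \<omega> f powr p = (LINT z|disc_area. cmod (f z) powr p * \<omega> z)"
proof -
  have "0 \<le> (LINT z|disc_area. cmod (f z) powr p * \<omega> z)"
    by (rule Bochner_Integration.integral_nonneg) (use assms(2) in \<open>simp add: disc_area_def space_scale_measure\<close>)
  thus ?thesis using \<open>p > 0\<close> by (simp add: bergman_norm_def powr_powr)
qed

text \<open>C is fixed before p, \<nu>, E, f and \<epsilon> are introduced; this expresses that it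
  depends on r and \<omega> only.\<close>

lemma small_value_set_estimate:
  assumes "0 < r" "r < 1" "\<omega> \<in> D_hat"
  obtains C where "C > 0"
    "\<And>p \<nu> E f \<epsilon>. 0 < p \<Longrightarrow> 0 < \<epsilon> \<Longrightarrow>
      (\<And>z. z \<in> \<bbbD> \<Longrightarrow> E z \<in> sets \<nu> \<and> E z \<subseteq> pseudohyperbolic_disc z r) \<Longrightarrow>
      f \<in> bergman_space p \<omega> \<Longrightarrow> small_value_set p \<nu> E f \<epsilon> \<in> sets disc_area \<Longrightarrow>
      (LINT z:small_value_set p \<nu> E f \<epsilon>|disc_area. cmod (f z) powr p * \<omega> z)
        \<le> C * \<epsilon> * (LINT z|disc_area. cmod (f z) powr p * \<omega> z)"
proof -
  define \<kappa> where "\<kappa> = 1 + 2 * r / (1 - r)"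
  have \<kappa>: "\<kappa> \<ge> 1" using assms by (simp add: \<kappa>_def)
  obtain w K where w [measurable]: "w \<in> borel_measurable borel"
    and \<omega>w: "AE z in lborel. z \<in> \<bbbD> \<longrightarrow> \<omega> z = w (cmod z)" and K: "K \<ge> 0"
    and tail: "\<And>t. 0 \<le> t \<Longrightarrow> t < 1 \<Longrightarrow>
      (\<integral>\<^sup>+z\<in>{z. 1 - 2 * \<kappa> * (1 - t) \<le> cmod z \<and> cmod z < 1}. ennreal (w (cmod z)) \<partial>lborel)
        \<le> ennreal K * (\<integral>\<^sup>+z\<in>{z. t < cmod z \<and> cmod z < 1}. ennreal (w (cmod z)) \<partial>lborel)"
    using D_hat_radial_tail[OF assms(3), of "2 * \<kappa>"] by blast
  have \<omega>0: "0 \<le> \<omega> z" if "z \<in> \<bbbD>" for z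
    using assms(3) that unfolding D_hat_def radial_weight_def weight_def by blast
  show ?thesis
  proof
    \<comment> \<open>The product of 4 \<kappa>^2 / pi from the sub-mean value property and pi
      \<kappa>^2 K from the comparison of weights; adding 1 keeps it positive when K = 0.\<close>
    show "4 * \<kappa> ^ 4 * K + 1 > 0" using K by (simp add: add_nonneg_pos)
    fix p \<epsilon> :: real and \<nu> :: "complex measure" and E :: "complex \<Rightarrow> complex set" and f :: "complex \<Rightarrow> complex"
    assume p: "0 < p" and \<epsilon>: "0 < \<epsilon>"
      and E: "\<And>z. z \<in> \<bbbD> \<Longrightarrow> E z \<in> sets \<nu> \<and> E z \<subseteq> pseudohyperbolic_disc z r"
      and f: "f \<in> bergman_space p \<omega>"
      and S [measurable]: "small_value_set p \<nu> E f \<epsilon> \<in> sets disc_area"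
    define S where "S = small_value_set p \<nu> E f \<epsilon>"
    define F where "F z = cmod (f z) powr p * \<omega> z" for z
    have hol: "f holomorphic_on \<bbbD>" and int: "integrable disc_area F"
      using f by (auto simp: bergman_space_def F_def[abs_def])
    have [measurable]: "S \<in> sets disc_area" using S by (simp add: S_def)
    have F0: "AE z in disc_area. 0 \<le> F z"
      by (rule AE_I2) (auto simp: F_def disc_area_def space_scale_measure intro!: mult_nonneg_nonneg \<omega>0)
    define I where "I = (LINT z|disc_area. F z)"
    define X where "X = (LINT z:S|disc_area. F z)"
    have I0: "I \<ge> 0" unfolding I_def using F0 by (rule integral_nonneg_AE)
    have intS: "integrable disc_area (\<lambda>z. indicator S z * F z)"
      using integrable_mult_indicator[OF _ int, of S] by simp
    have X0: "X \<ge> 0" unfolding X_def set_lebesgue_integral_def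
      by (rule integral_nonneg_AE, use F0 in eventually_elim) simp
    define c where "c = \<epsilon> * (4 * \<kappa>\<^sup>2 / pi)"
    have c: "c > 0" using \<epsilon> \<kappa> by (simp add: c_def)
    define N where "N z = (\<integral>\<^sup>+\<eta>\<in>disc_nbhd \<kappa> z. ennreal (cmod (f \<eta>) powr p) \<partial>lborel)" for z
    have point: "ennreal (cmod (f z) powr p) \<le> ennreal c * (ennreal (1 / (1 - cmod z)\<^sup>2) * N z)" if "z \<in> S" for z
    proof -
      have z: "z \<in> \<bbbD>" and le: "cmod (f z) powr p \<le> \<epsilon> * local_average p \<nu> E f z"
        using that by (auto simp: S_def small_value_set_def)
      have "ennreal (local_average p \<nu> E f z) \<le> ennreal (4 * \<kappa>\<^sup>2 / pi) * ennreal (1 / (1 - cmod z)\<^sup>2) * N z"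
      proof (rule local_average_le)
        fix \<zeta> assume "\<zeta> \<in> E z"
        hence "\<zeta> \<in> pseudohyperbolic_disc z r" using E[OF z] by blast
        thus "ennreal (cmod (f \<zeta>) powr p) \<le> ennreal (4 * \<kappa>\<^sup>2 / pi) * ennreal (1 / (1 - cmod z)\<^sup>2) * N z"
          using powr_le_integral_disc_nbhd[OF hol p _ assms(2) z] assms(1) by (simp add: N_def \<kappa>_def)
      qed (use E[OF z] in blast)
      hence "ennreal \<epsilon> * ennreal (local_average p \<nu> E f z) \<le> ennreal \<epsilon> * (ennreal (4 * \<kappa>\<^sup>2 / pi) * ennreal (1 / (1 - cmod z)\<^sup>2) * N z)"
        by (rule mult_left_mono) simp
      also have "ennreal \<epsilon> * ennreal (local_average p \<nu> E f z) = ennreal (\<epsilon> * local_average p \<nu> E f z)"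
        using \<epsilon> by (simp add: ennreal_mult')
      also have "ennreal \<epsilon> * (ennreal (4 * \<kappa>\<^sup>2 / pi) * ennreal (1 / (1 - cmod z)\<^sup>2) * N z) = ennreal c * (ennreal (1 / (1 - cmod z)\<^sup>2) * N z)"
      proof -
        have "ennreal c = ennreal \<epsilon> * ennreal (4 * \<kappa>\<^sup>2 / pi)" unfolding c_def using \<epsilon> by (intro ennreal_mult') simp
        thus ?thesis by (simp only: mult.assoc)
      qed
      finally show ?thesis using ennreal_leI[OF le] by (rule order_trans[rotated])
    qed
    \<comment> \<open>Dividing by c beforehand lets the factor of the pointwise bound cancel, so
      that what remains is the integral estimated by
      \<open>integral_disc_nbhd_weight_le\<close>.\<close>
    have "ennreal (X / c) = (\<integral>\<^sup>+z. ennreal (indicator S z * F z / c) \<partial>disc_area)"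
    proof -
      have "X / c = (LINT z|disc_area. indicator S z * F z / c)"
        by (simp add: X_def set_lebesgue_integral_def)
      moreover have "AE z in disc_area. 0 \<le> indicator S z * F z / c"
        using F0 by eventually_elim (use c in simp)
      hence "(\<integral>\<^sup>+z. ennreal (indicator S z * F z / c) \<partial>disc_area) = ennreal (LINT z|disc_area. indicator S z * F z / c)"
        by (intro nn_integral_eq_integral integrable_divide intS)
      ultimately show ?thesis by (simp only:)
    qed
    also have "\<dots> = ennreal (1 / pi) * (\<integral>\<^sup>+z\<in>\<bbbD>. ennreal (indicator S z * F z / c) \<partial>lborel)"
      by (intro nn_integral_disc_area measurable_compose[OF _ measurable_ennreal] borel_measurable_integrable
            integrable_divide intS)
    also have "\<dots> \<le> ennreal (1 / pi) * (\<integral>\<^sup>+z\<in>\<bbbD>. ennreal (w (cmod z)) * (ennreal (1 / (1 - cmod z)\<^sup>2) * N z) \<partial>lborel)"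
    proof (intro mult_left_mono nn_integral_mono_AE)
      show "AE z in lborel. ennreal (indicator S z * F z / c) * indicator \<bbbD> z
          \<le> ennreal (w (cmod z)) * (ennreal (1 / (1 - cmod z)\<^sup>2) * N z) * indicator \<bbbD> z"
        using \<omega>w
      proof eventually_elim
        case (elim z)
        show ?case
        proof (cases "z \<in> S \<and> z \<in> \<bbbD>")
          case True
          have "ennreal (F z / c) = ennreal (1 / c) * (ennreal (\<omega> z) * ennreal (cmod (f z) powr p))"
            using True \<omega>0[of z] c by (simp add: F_def mult.commute flip: ennreal_mult)
          also have "\<dots> \<le> ennreal (1 / c) * (ennreal (\<omega> z) * (ennreal c * (ennreal (1 / (1 - cmod z)\<^sup>2) * N z)))"
            using True by (intro mult_left_mono point) auto
          also have "\<dots> = (ennreal (1 / c) * ennreal c) * (ennreal (\<omega> z) * (ennreal (1 / (1 - cmod z)\<^sup>2) * N z))"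
            by (simp only: mult_ac)
          also have "ennreal (1 / c) * ennreal c = 1" using c by (simp flip: ennreal_mult)
          finally show ?thesis using True elim by (simp add: indicator_def)
        qed (auto simp: indicator_def)
      qed
    qed simp
    also have "\<dots> \<le> ennreal (1 / pi) * (ennreal (pi * \<kappa>\<^sup>2 * K) * (\<integral>\<^sup>+z\<in>\<bbbD>. ennreal (cmod (f z) powr p) * ennreal (w (cmod z)) \<partial>lborel))"
      unfolding N_def by (intro mult_left_mono integral_disc_nbhd_weight_le \<kappa> K tail hol p) simp_all
    also have "(\<integral>\<^sup>+z\<in>\<bbbD>. ennreal (cmod (f z) powr p) * ennreal (w (cmod z)) \<partial>lborel) = (\<integral>\<^sup>+z\<in>\<bbbD>. ennreal (F z) \<partial>lborel)"
      by (rule nn_integral_cong_AE, use \<omega>w in eventually_elim)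
         (use \<omega>0 in \<open>auto simp: F_def ennreal_mult' indicator_def\<close>)
    also have "ennreal (1 / pi) * (ennreal (pi * \<kappa>\<^sup>2 * K) * (\<integral>\<^sup>+z\<in>\<bbbD>. ennreal (F z) \<partial>lborel))
        = ennreal (pi * \<kappa>\<^sup>2 * K) * (\<integral>\<^sup>+z. ennreal (F z) \<partial>disc_area)"
      using borel_measurable_integrable[OF int] by (subst nn_integral_disc_area) (auto simp: mult_ac)
    also have "(\<integral>\<^sup>+z. ennreal (F z) \<partial>disc_area) = ennreal I"
      unfolding I_def using int F0 by (rule nn_integral_eq_integral)
    also have "ennreal (pi * \<kappa>\<^sup>2 * K) * ennreal I = ennreal (pi * \<kappa>\<^sup>2 * K * I)"
      using K I0 by (simp add: ennreal_mult)
    finally have "X / c \<le> pi * \<kappa>\<^sup>2 * K * I" using K I0 by (simp add: ennreal_le_iff)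
    hence "X \<le> 4 * \<kappa> ^ 4 * K * \<epsilon> * I"
      using c by (simp add: c_def field_simps power2_eq_square power4_eq_xxxx)
    also have "\<dots> \<le> (4 * \<kappa> ^ 4 * K + 1) * \<epsilon> * I"
      using \<epsilon> I0 by (intro mult_right_mono) auto
    finally show "(LINT z:small_value_set p \<nu> E f \<epsilon>|disc_area. cmod (f z) powr p * \<omega> z)
        \<le> (4 * \<kappa> ^ 4 * K + 1) * \<epsilon> * (LINT z|disc_area. cmod (f z) powr p * \<omega> z)"
      by (simp add: X_def I_def F_def S_def)
  qed
qed

theorem theorem8:
  fixes r :: real and \<omega> :: "complex \<Rightarrow> real"
  assumes "0 < r" and "r < 1"
    and "\<omega> \<in> D_hat"
    and "\<forall>z\<in>\<bbbD>. weight_hat \<omega> z > 0"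
  shows "\<exists>C>0. \<exists>\<epsilon>\<^sub>0>0.
    \<forall>(p::real) (\<nu>::complex measure) (E::complex \<Rightarrow> complex set) (f::complex \<Rightarrow> complex) (\<epsilon>::real).
      0 < p \<and> 0 < \<epsilon> \<and>
      locally_finite_disc_measure \<nu> \<and>
      (\<forall>z\<in>\<bbbD>. E z \<in> sets \<nu> \<and> E z \<subseteq> pseudohyperbolic_disc z r \<and> emeasure \<nu> (E z) > 0) \<and>
      f \<in> bergman_space p \<omega> \<and>
      small_value_set p \<nu> E f \<epsilon> \<in> sets disc_area
      \<longrightarrow>
      (LINT z:small_value_set p \<nu> E f \<epsilon>|disc_area. cmod (f z) powr p * \<omega> z)
          \<le> C * \<epsilon> * bergman_norm p \<omega> f powr p \<and>
      (\<epsilon> < \<epsilon>\<^sub>0 \<longrightarrow> dominating_set p \<omega> f (\<bbbD> - small_value_set p \<nu> E f \<epsilon>))"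
proof -
  obtain C where C: "C > 0"
    "\<And>p \<nu> E f \<epsilon>. 0 < p \<Longrightarrow> 0 < \<epsilon> \<Longrightarrow>
      (\<And>z. z \<in> \<bbbD> \<Longrightarrow> E z \<in> sets \<nu> \<and> E z \<subseteq> pseudohyperbolic_disc z r) \<Longrightarrow>
      f \<in> bergman_space p \<omega> \<Longrightarrow> small_value_set p \<nu> E f \<epsilon> \<in> sets disc_area \<Longrightarrow>
      (LINT z:small_value_set p \<nu> E f \<epsilon>|disc_area. cmod (f z) powr p * \<omega> z)
        \<le> C * \<epsilon> * (LINT z|disc_area. cmod (f z) powr p * \<omega> z)"
    using small_value_set_estimate[OF assms(1-3)] by blast
  have \<omega>0: "\<And>z. z \<in> \<bbbD> \<Longrightarrow> 0 \<le> \<omega> z"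
    using assms(3) unfolding D_hat_def radial_weight_def weight_def by blast
  show ?thesis
  \<comment> \<open>Below 1/(2C) the exceptional set carries at most half of the norm integral, so
    its complement carries at least half: \<delta> = 1/2 works for every f.\<close>
  proof (rule exI[of _ C], intro conjI exI[of _ "1 / (2 * C)"] allI impI)
    show "C > 0" "1 / (2 * C) > 0" using C(1) by simp_all
    fix p \<epsilon> :: real and \<nu> :: "complex measure" and E :: "complex \<Rightarrow> complex set" and f :: "complex \<Rightarrow> complex"
    assume *: "0 < p \<and> 0 < \<epsilon> \<and> locally_finite_disc_measure \<nu> \<and>
      (\<forall>z\<in>\<bbbD>. E z \<in> sets \<nu> \<and> E z \<subseteq> pseudohyperbolic_disc z r \<and> emeasure \<nu> (E z) > 0) \<and>
      f \<in> bergman_space p \<omega> \<and> small_value_set p \<nu> E f \<epsilon> \<in> sets disc_area"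
    define S where "S = small_value_set p \<nu> E f \<epsilon>"
    define F where "F z = cmod (f z) powr p * \<omega> z" for z
    have S: "S \<in> sets disc_area" using * by (simp add: S_def)
    have int: "integrable disc_area F" using * by (auto simp: bergman_space_def F_def[abs_def])
    have norm: "bergman_norm p \<omega> f powr p = (LINT z|disc_area. F z)"
      unfolding F_def by (rule bergman_norm_powr) (use * \<omega>0 in auto)
    have est: "(LINT z:S|disc_area. F z) \<le> C * \<epsilon> * bergman_norm p \<omega> f powr p"
      unfolding norm unfolding F_def S_def by (rule C(2)) (use * in auto)
    thus "(LINT z:small_value_set p \<nu> E f \<epsilon>|disc_area. cmod (f z) powr p * \<omega> z)
          \<le> C * \<epsilon> * bergman_norm p \<omega> f powr p"
      by (simp add: F_def S_def)
    assume "\<epsilon> < 1 / (2 * C)"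
    hence "C * \<epsilon> \<le> 1 / 2" using C(1) by (simp add: field_simps)
    hence "C * \<epsilon> * bergman_norm p \<omega> f powr p \<le> 1 / 2 * bergman_norm p \<omega> f powr p"
      by (rule mult_right_mono) simp
    with est have half: "(LINT z:S|disc_area. F z) \<le> 1 / 2 * bergman_norm p \<omega> f powr p" by linarith
    have space: "space disc_area = \<bbbD>" by (simp add: disc_area_def space_scale_measure)
    have "(LINT z:\<bbbD> - S|disc_area. F z) = (LINT z|disc_area. F z - indicator S z * F z)"
      unfolding set_lebesgue_integral_def
      by (intro Bochner_Integration.integral_cong) (auto simp: space indicator_def)
    also have "\<dots> = (LINT z|disc_area. F z) - (LINT z:S|disc_area. F z)"
      unfolding set_lebesgue_integral_def using int integrable_mult_indicator[OF S int]
      by (subst Bochner_Integration.integral_diff) auto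
    finally have "(LINT z:\<bbbD> - S|disc_area. F z) \<ge> 1 / 2 * bergman_norm p \<omega> f powr p"
      using half norm by linarith
    moreover have "\<bbbD> - S \<in> sets disc_area"
      using S sets.top[of disc_area] unfolding space by (rule sets.Diff[rotated])
    ultimately show "dominating_set p \<omega> f (\<bbbD> - small_value_set p \<nu> E f \<epsilon>)"
      unfolding dominating_set_def F_def S_def by (intro conjI exI[of _ "1 / 2"]) auto
  qed
qed

end
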